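(* Let $\varphi:\mathbb{P}^1_K\to\mathbb{P}^1_K$ be a morphism of degree $2$ given in normal form $$\varphi=\frac{X^2+\lambda_1XY}{\lambda_2XY+Y^2},\qquad \lambda_1,\lambda_2\in K,$$ and let $\Phi=[1,\lambda_1,0,0,\lambda_2,1]\in\mathbb{P}^5(K)$ be the corresponding presentation. Suppose that $\Phi$ has semi-stable reduction at every closed point of $C$. (Then the poles of $\lambda_1$ and of $\lambda_2$ occur at exactly the same points of $C$.) Let $P$ be the set of common poles of $\lambda_1$ and $\lambda_2$ in $C$. Then $(1,\lambda_1,0,0,\lambda_2,1)$ is a $P$-minimal global model for $\varphi$; that is, with $U=C\setminus P$, its coordinates lie in $\mathcal{O}_C(U)$ and $v_p(\rho(1,\lambda_1,0,0,\lambda_2,1))=(R_\varphi)_p$ for every closed point $p\in U$.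
   Context: Setting: $C$ is a noetherian integral one-dimensional scheme whose local rings at closed points are discrete valuation rings, and $K$ is its function field, of characteristic $0$ (e.g. $C=\mathrm{Spec}(\mathcal{O}_K)$ for a number field $K$, or a nonsingular curve over an algebraically closed field of characteristic $0$). For a closed point $p\in C$, $v_p$ is the normalized valuation of $\mathcal{O}_{C,p}$ and $\kappa(p)$ the residue field. Presentations: fix coordinates $[X,Y]$ on $\mathbb{P}^1_K$. A presentation of a degree $d$ morphism $\varphi$ is the point $\Phi=[\mathbf{a},\mathbf{b}]=[a_0,\dots,a_d,b_0,\dots,b_d]\in\mathbb{P}^{2d+1}(K)$ of coefficients of homogeneous forms $F_{\mathbf a}=\sum a_iX^{d-i}Y^i$, $F_{\mathbf b}=\sum b_iX^{d-i}Y^i$ without common zero in $\mathbb{P}^1(\bar K)$ with $\varphi=[F_{\mathbf a}:F_{\mathbf b}]$. A model of $\Phi$ is an affine representative $(\mathbf a,\mathbf b)\in K^{2d+2}$. $\rho(\mathbf a,\mathbf b)$ denotes the resultant of $F_{\mathbf a},F_{\mathbf b}$ as forms of degree $d$ (the $2d\times 2d$ Sylvester determinant). Action: for $\Gamma=\begin{pmatrix}\alpha&\beta\\ \gamma&\delta\end{pmatrix}\in\mathrm{GL}_2(K)$, $(\mathbf a^\Gamma,\mathbf b^\Gamma)$ are the coefficients of $\Gamma^{\mathrm{adj}}\cdot\big(F_{\mathbf a}(\alpha X+\beta Y,\gamma X+\delta Y),\,F_{\mathbf b}(\alpha X+\beta Y,\gamma X+\delta Y)\big)^T$, with $\Gamma^{\mathrm{adj}}=\begin{pmatrix}\delta&-\beta\\-\gamma&\alpha\end{pmatrix}$;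 this induces the conjugation action $\Phi\mapsto\Phi^\Gamma$ of $\mathrm{PGL}_2(K)$. Minimal resultant: $n_p(\mathbf a,\mathbf b)$ is the minimum of $v_p$ over all coordinates, $N_{\Phi,p}=v_p(\rho(\mathbf a,\mathbf b))-2d\,n_p(\mathbf a,\mathbf b)$ (independent of the model), and $R_\varphi=\sum_p\min_{\Gamma\in \mathrm{PGL}_2(K)}N_{\Phi^\Gamma,p}\,[p]$; $(R_\varphi)_p$ is its coefficient at $p$. Reduction: scaling a model so that $n_p=0$ and reducing the coordinates modulo $p$ gives the reduction $\Phi_p\in\mathbb{P}^{2d+1}(\kappa(p))$. A point of $\mathbb{P}^{2d+1}(F)$, $F$ a field, is unstable if over $\bar F$ it is $\mathrm{SL}_2(\bar F)$-conjugate to a point with $a_i=0$ for all $i\le\frac{d-1}{2}$ and $b_j=0$ for all $j\le\frac{d+1}{2}$; otherwise it is semi-stable (this is GIT semi-stability for the conjugation action). $\Phi$ has semi-stable reduction at $p$ if $\Phi_p$ is semi-stable. For $U\subseteq C$ open with complement $S$, an $S$-minimal global model of $\varphi$ is a model $(\mathbf a,\mathbf b)$ over $\mathcal{O}_C(U)$ of a presentation of $\varphi$ such that $(R_\varphi)_p=v_p(\rho(\mathbf a,\mathbf b))$ for every closed point $p\in U$. *)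

theory Defs
  imports
    "HOL-Analysis.Abstract_Topology"
    "HOL-Analysis.Function_Topology"
    "HOL-Algebra.Algebra"
    "HOL-Algebra.Algebraic_Closure_Type"
    "Subresultants.Resultant_Prelim"
begin

section \<open>Integral schemes with a given function field\<close>

text \<open>
  On an integral scheme all sections over nonempty open sets, and all local rings, are canonically
  subrings of the function field, and the restriction maps become inclusions.  An integral scheme
  with function field the type \<open>'k\<close> is therefore given by a topology \<open>C\<close> on its set of points
  together with the subring \<open>sh U\<close> of \<open>'k\<close> for each nonempty open \<open>U\<close>.  The value \<open>sh {}\<close> plays
  no role (the zero ring is not a subring of \<open>'k\<close>).
\<close>

definition subring_of :: "'k::field set \<Rightarrow> 'k ring" where
  "subring_of A = (ring_of_type_algebra :: 'k ring)\<lparr>carrier := A\<rparr>"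

definition stalk :: "'x topology \<Rightarrow> ('x set \<Rightarrow> 'k::field set) \<Rightarrow> 'x \<Rightarrow> 'k set" where
  "stalk C sh p = \<Union>{sh U | U. openin C U \<and> p \<in> U}"

abbreviation local_ring :: "'x topology \<Rightarrow> ('x set \<Rightarrow> 'k::field set) \<Rightarrow> 'x \<Rightarrow> 'k ring" where
  "local_ring C sh p \<equiv> subring_of (stalk C sh p)"

definition max_ideal :: "'x topology \<Rightarrow> ('x set \<Rightarrow> 'k::field set) \<Rightarrow> 'x \<Rightarrow> 'k set" where
  "max_ideal C sh p = stalk C sh p - Units (local_ring C sh p)"

definition zariski :: "('a, 'm) ring_scheme \<Rightarrow> 'a set topology" where
  "zariski R = topology_generated_by {{Q. primeideal Q R \<and> f \<notin> Q} | f. f \<in> carrier R}"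

text \<open>
  If \<open>U\<close> is affine, the isomorphism from \<open>U\<close> to the spectrum of \<open>sh U\<close> is the canonical map, sending
  \<open>x\<close> to the prime of all sections that are not invertible at \<open>x\<close>.  Since principal open sets form a
  basis, the structure sheaf is that of the spectrum as soon as, for every nonzero \<open>f\<close>, its sections
  over the principal open set of \<open>f\<close> are the fractions with denominator a power of \<open>f\<close>.
\<close>

definition affine_open :: "'x topology \<Rightarrow> ('x set \<Rightarrow> 'k::field set) \<Rightarrow> 'x set \<Rightarrow> bool" where
  "affine_open C sh U \<longleftrightarrow>
     openin C U \<and> U \<noteq> {} \<and>
     homeomorphic_map (subtopology C U) (zariski (subring_of (sh U)))
       (\<lambda>x. {f \<in> sh U. f \<in> max_ideal C sh x}) \<and>
     (\<forall>f\<in>sh U. f \<noteq> 0 \<longrightarrow>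
        sh {x \<in> U. f \<notin> max_ideal C sh x} = {g / f ^ n | g n. g \<in> sh U})"

locale integral_scheme =
  fixes C :: "'x topology" and sh :: "'x set \<Rightarrow> 'k::field set"
  assumes nonempty: "topspace C \<noteq> {}"
    and irreducible: "\<lbrakk>openin C U; U \<noteq> {}; openin C V; V \<noteq> {}\<rbrakk> \<Longrightarrow> U \<inter> V \<noteq> {}"
    and sections_subring:
      "\<lbrakk>openin C U; U \<noteq> {}\<rbrakk> \<Longrightarrow> subring (sh U) (ring_of_type_algebra :: 'k ring)"
    and restriction: "\<lbrakk>openin C U; openin C V; V \<noteq> {}; V \<subseteq> U\<rbrakk> \<Longrightarrow> sh U \<subseteq> sh V"
    and gluing:
      "\<lbrakk>\<U> \<noteq> {}; \<And>U. U \<in> \<U> \<Longrightarrow> openin C U \<and> U \<noteq> {}\<rbrakk> \<Longrightarrow> (\<Inter>U\<in>\<U>. sh U) \<subseteq> sh (\<Union>\<U>)"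
    and locally_affine: "x \<in> topspace C \<Longrightarrow> \<exists>U. affine_open C sh U \<and> x \<in> U"
    and function_field: "(\<Union>{sh U | U. openin C U \<and> U \<noteq> {}}) = UNIV"

definition noetherian_scheme :: "'x topology \<Rightarrow> ('x set \<Rightarrow> 'k::field set) \<Rightarrow> bool" where
  "noetherian_scheme C sh \<longleftrightarrow>
     (\<exists>\<U>. finite \<U> \<and> \<Union>\<U> = topspace C \<and>
        (\<forall>U\<in>\<U>. affine_open C sh U \<and> noetherian_ring (subring_of (sh U))))"

definition irreducible_closed :: "'x topology \<Rightarrow> 'x set \<Rightarrow> bool" where
  "irreducible_closed C Z \<longleftrightarrow>
     closedin C Z \<and> Z \<noteq> {} \<and>
     (\<forall>A B. closedin C A \<and> closedin C B \<and> Z \<subseteq> A \<union> B \<longrightarrow> Z \<subseteq> A \<or> Z \<subseteq> B)"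

definition one_dimensional :: "'x topology \<Rightarrow> bool" where
  "one_dimensional C \<longleftrightarrow>
     (\<exists>Z0 Z1. irreducible_closed C Z0 \<and> irreducible_closed C Z1 \<and> Z0 \<subset> Z1) \<and>
     \<not> (\<exists>Z0 Z1 Z2. irreducible_closed C Z0 \<and> irreducible_closed C Z1 \<and>
          irreducible_closed C Z2 \<and> Z0 \<subset> Z1 \<and> Z1 \<subset> Z2)"

definition closed_points :: "'x topology \<Rightarrow> 'x set" where
  "closed_points C = {p. closedin C {p}}"

definition discrete_valuation_ring :: "('a, 'm) ring_scheme \<Rightarrow> bool" where
  "discrete_valuation_ring R \<longleftrightarrow>
     principal_domain R \<and> (\<exists>!M. maximalideal M R) \<and> \<not> field R"

section \<open>Valuations and residue fields at closed points\<close>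

text \<open>
  The valuation is only meaningful on nonzero elements: instead of giving \<open>0\<close> the value infinity,
  the definitions below never evaluate it at \<open>0\<close> (resultants of presentations are nonzero).
\<close>

definition val :: "'x topology \<Rightarrow> ('x set \<Rightarrow> 'k::field set) \<Rightarrow> 'x \<Rightarrow> 'k \<Rightarrow> int" where
  "val C sh p x =
     (THE n. \<exists>t\<in>stalk C sh p. \<exists>u\<in>Units (local_ring C sh p).
        max_ideal C sh p = PIdl\<^bsub>local_ring C sh p\<^esub> t \<and> x = u * t powi n)"

definition poles :: "'x topology \<Rightarrow> ('x set \<Rightarrow> 'k::field set) \<Rightarrow> 'k \<Rightarrow> 'x set" where
  "poles C sh x = {p \<in> closed_points C. x \<noteq> 0 \<and> val C sh p x < 0}"

definition residue_field ::
    "'x topology \<Rightarrow> ('x set \<Rightarrow> 'k::field set) \<Rightarrow> 'x \<Rightarrow> 'k set ring" where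
  "residue_field C sh p = local_ring C sh p Quot max_ideal C sh p"

definition residue :: "'x topology \<Rightarrow> ('x set \<Rightarrow> 'k::field set) \<Rightarrow> 'x \<Rightarrow> 'k \<Rightarrow> 'k set" where
  "residue C sh p x = max_ideal C sh p +>\<^bsub>local_ring C sh p\<^esub> x"

section \<open>Projective points and the conjugation action\<close>

text \<open>
  A point of projective \<open>n\<close>-space is the set of all its affine representatives, these being lists
  of length \<open>n + 1\<close>.
\<close>

definition proj_point :: "('a, 'm) ring_scheme \<Rightarrow> 'a list \<Rightarrow> 'a list set" where
  "proj_point R v = {map (\<lambda>x. c \<otimes>\<^bsub>R\<^esub> x) v | c. c \<in> carrier R - {\<zero>\<^bsub>R\<^esub>}}"

definition proj_space :: "('a, 'm) ring_scheme \<Rightarrow> nat \<Rightarrow> 'a list set set" where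
  "proj_space R n =
     {proj_point R v | v. length v = n + 1 \<and> set v \<subseteq> carrier R \<and> \<not> set v \<subseteq> {\<zero>\<^bsub>R\<^esub>}}"

text \<open>
  A model \<open>v = [a\<^sub>0,\<dots>,a\<^sub>d,b\<^sub>0,\<dots>,b\<^sub>d]\<close> is a list of length \<open>2 * d + 2\<close>; \<open>Fa\<close> and \<open>Fb\<close> extract
  the coefficient lists of its two forms.  The coefficient with index \<open>i\<close> of a form of degree \<open>d\<close> is
  the one of \<open>X ^ (d - i) * Y ^ i\<close>.
\<close>

definition Fa :: "nat \<Rightarrow> 'a list \<Rightarrow> 'a list" where
  "Fa d v = take (d + 1) v"

definition Fb :: "nat \<Rightarrow> 'a list \<Rightarrow> 'a list" where
  "Fb d v = drop (d + 1) v"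

type_synonym 'a mat2 = "'a \<times> 'a \<times> 'a \<times> 'a"

text \<open>The tuple \<open>(\<alpha>, \<beta>, \<gamma>, \<delta>)\<close> is the matrix with rows \<open>(\<alpha>, \<beta>)\<close> and \<open>(\<gamma>, \<delta>)\<close>.\<close>

definition GL2 :: "('a, 'm) ring_scheme \<Rightarrow> 'a mat2 set" where
  "GL2 R = {(\<alpha>, \<beta>, \<gamma>, \<delta>). {\<alpha>, \<beta>, \<gamma>, \<delta>} \<subseteq> carrier R \<and>
     \<alpha> \<otimes>\<^bsub>R\<^esub> \<delta> \<ominus>\<^bsub>R\<^esub> \<beta> \<otimes>\<^bsub>R\<^esub> \<gamma> \<in> Units R}"

definition SL2 :: "('a, 'm) ring_scheme \<Rightarrow> 'a mat2 set" where
  "SL2 R = {(\<alpha>, \<beta>, \<gamma>, \<delta>). {\<alpha>, \<beta>, \<gamma>, \<delta>} \<subseteq> carrier R \<and>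
     \<alpha> \<otimes>\<^bsub>R\<^esub> \<delta> \<ominus>\<^bsub>R\<^esub> \<beta> \<otimes>\<^bsub>R\<^esub> \<gamma> = \<one>\<^bsub>R\<^esub>}"

text \<open>
  Coefficients of \<open>F (\<alpha> X + \<beta> Y, \<gamma> X + \<delta> Y)\<close>, where \<open>F\<close> has degree \<open>d\<close> and coefficients \<open>c\<close>: the
  coefficient of \<open>Y ^ k\<close> in \<open>(\<alpha> X + \<beta> Y) ^ (d - i)\<close> is multiplied by that of \<open>Y ^ (j - k)\<close> in
  \<open>(\<gamma> X + \<delta> Y) ^ i\<close>.  Truncated subtraction only happens where a binomial coefficient vanishes.
\<close>

definition form_subst :: "('a, 'm) ring_scheme \<Rightarrow> nat \<Rightarrow> 'a mat2 \<Rightarrow> 'a list \<Rightarrow> 'a list" where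
  "form_subst R d = (\<lambda>(\<alpha>, \<beta>, \<gamma>, \<delta>) c.
     map (\<lambda>j. \<Oplus>\<^bsub>R\<^esub>i\<in>{..d}. \<Oplus>\<^bsub>R\<^esub>k\<in>{..j}.
            add_pow R (((d - i) choose k) * (i choose (j - k)))
            (c ! i \<otimes>\<^bsub>R\<^esub>
               ((\<alpha> [^]\<^bsub>R\<^esub> (d - i - k) \<otimes>\<^bsub>R\<^esub> \<beta> [^]\<^bsub>R\<^esub> k) \<otimes>\<^bsub>R\<^esub>
                (\<gamma> [^]\<^bsub>R\<^esub> (i - (j - k)) \<otimes>\<^bsub>R\<^esub> \<delta> [^]\<^bsub>R\<^esub> (j - k)))))
       [0..<d + 1])"

definition conj_model :: "('a, 'm) ring_scheme \<Rightarrow> nat \<Rightarrow> 'a mat2 \<Rightarrow> 'a list \<Rightarrow> 'a list" where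
  "conj_model R d = (\<lambda>(\<alpha>, \<beta>, \<gamma>, \<delta>) v.
     let A = form_subst R d (\<alpha>, \<beta>, \<gamma>, \<delta>) (Fa d v);
         B = form_subst R d (\<alpha>, \<beta>, \<gamma>, \<delta>) (Fb d v)
     in map (\<lambda>j. \<delta> \<otimes>\<^bsub>R\<^esub> A ! j \<ominus>\<^bsub>R\<^esub> \<beta> \<otimes>\<^bsub>R\<^esub> B ! j) [0..<d + 1] @
        map (\<lambda>j. \<alpha> \<otimes>\<^bsub>R\<^esub> B ! j \<ominus>\<^bsub>R\<^esub> \<gamma> \<otimes>\<^bsub>R\<^esub> A ! j) [0..<d + 1])"

text \<open>
  Instability of a point over the field \<open>F\<close>, tested over the algebraic closure of \<open>F\<close>, into which
  \<open>F\<close> embeds by \<open>indexed_const\<close>.  The bounds \<open>i \<le> (d - 1) / 2\<close> and \<open>i \<le> (d + 1) / 2\<close> are cleared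
  of denominators.
\<close>

definition unstable :: "('a, 'm) ring_scheme \<Rightarrow> nat \<Rightarrow> 'a list set \<Rightarrow> bool" where
  "unstable F d \<Psi> \<longleftrightarrow>
     (\<exists>w\<in>\<Psi>. \<exists>\<Gamma>\<in>SL2 (field.alg_closure F).
        let L = field.alg_closure F;
            u = conj_model L d \<Gamma> (map (ring.indexed_const F) w)
        in \<forall>i\<le>d. (2 * i + 1 \<le> d \<longrightarrow> Fa d u ! i = \<zero>\<^bsub>L\<^esub>) \<and>
                 (2 * i \<le> d + 1 \<longrightarrow> Fb d u ! i = \<zero>\<^bsub>L\<^esub>))"

definition semistable :: "('a, 'm) ring_scheme \<Rightarrow> nat \<Rightarrow> 'a list set \<Rightarrow> bool" where
  "semistable F d \<Psi> \<longleftrightarrow> \<Psi> \<in> proj_space F (2 * d + 1) \<and> \<not> unstable F d \<Psi>"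

section \<open>Presentations of morphisms, resultants and reduction\<close>

definition form_eval :: "nat \<Rightarrow> 'k::field list \<Rightarrow> 'k alg_closure \<Rightarrow> 'k alg_closure \<Rightarrow> 'k alg_closure"
  where "form_eval d c x y = (\<Sum>i\<le>d. to_ac (c ! i) * x ^ (d - i) * y ^ i)"

abbreviation P1_point :: "'k::field \<Rightarrow> 'k \<Rightarrow> 'k list set" where
  "P1_point x y \<equiv> proj_point ring_of_type_algebra [x, y]"

text \<open>
  A morphism from the projective line over \<open>'k\<close> to itself is given by its action on the points over
  the algebraic closure; outside the set of such points the value of \<open>\<phi>\<close> is irrelevant.
\<close>

type_synonym 'k P1_map = "'k alg_closure list set \<Rightarrow> 'k alg_closure list set"

definition presentation :: "nat \<Rightarrow> 'k::field P1_map \<Rightarrow> 'k list set \<Rightarrow> bool" where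
  "presentation d \<phi> \<Phi> \<longleftrightarrow>
     \<Phi> \<in> proj_space ring_of_type_algebra (2 * d + 1) \<and>
     (\<forall>v\<in>\<Phi>. \<forall>x y. (x, y) \<noteq> (0, 0) \<longrightarrow>
        (form_eval d (Fa d v) x y, form_eval d (Fb d v) x y) \<noteq> (0, 0) \<and>
        \<phi> (P1_point x y) = P1_point (form_eval d (Fa d v) x y) (form_eval d (Fb d v) x y))"

text \<open>
  The library's Sylvester matrix with prescribed degrees \<open>d\<close> and \<open>d\<close>, so that leading coefficients
  are allowed to vanish; \<open>Poly\<close> expects the constant coefficient first, whence \<open>rev\<close>.
\<close>

definition resultant_form :: "nat \<Rightarrow> 'k::field list \<Rightarrow> 'k" where
  "resultant_form d v =
     Determinant.det (sylvester_mat_sub d d (Poly (rev (Fa d v))) (Poly (rev (Fb d v))))"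

definition min_val :: "'x topology \<Rightarrow> ('x set \<Rightarrow> 'k::field set) \<Rightarrow> 'x \<Rightarrow> 'k list \<Rightarrow> int" where
  "min_val C sh p v = Min (val C sh p ` (set v - {0}))"

definition res_order ::
    "'x topology \<Rightarrow> ('x set \<Rightarrow> 'k::field set) \<Rightarrow> nat \<Rightarrow> 'x \<Rightarrow> 'k list \<Rightarrow> int" where
  "res_order C sh d p v =
     val C sh p (resultant_form d v) - 2 * int d * min_val C sh p v"

text \<open>
  The coefficient at \<open>p\<close> of the minimal resultant divisor of \<open>\<phi>\<close>.  The order \<open>res_order\<close> does not
  depend on the model, so one may range over all models of the presentation; likewise scalar matrices
  do not matter, so matrices in \<open>GL2\<close> replace their classes in \<open>PGL2\<close>.
\<close>

definition min_resultant ::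
    "'x topology \<Rightarrow> ('x set \<Rightarrow> 'k::field set) \<Rightarrow> nat \<Rightarrow> 'k P1_map \<Rightarrow> 'x \<Rightarrow> int" where
  "min_resultant C sh d \<phi> p =
     (LEAST n. \<exists>\<Phi>. presentation d \<phi> \<Phi> \<and>
        (\<exists>v\<in>\<Phi>. \<exists>\<Gamma>\<in>GL2 ring_of_type_algebra.
           n = res_order C sh d p (conj_model ring_of_type_algebra d \<Gamma> v)))"

text \<open>
  The residues of all models with minimal valuation \<open>0\<close> are precisely the representatives of one
  point over the residue field.
\<close>

definition reduction ::
    "'x topology \<Rightarrow> ('x set \<Rightarrow> 'k::field set) \<Rightarrow> 'x \<Rightarrow> 'k list set \<Rightarrow> 'k set list set" where
  "reduction C sh p \<Phi> = {map (residue C sh p) v | v. v \<in> \<Phi> \<and> min_val C sh p v = 0}"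

definition semistable_reduction ::
    "'x topology \<Rightarrow> ('x set \<Rightarrow> 'k::field set) \<Rightarrow> nat \<Rightarrow> 'k list set \<Rightarrow> 'x \<Rightarrow> bool" where
  "semistable_reduction C sh d \<Phi> p \<longleftrightarrow>
     semistable (residue_field C sh p) d (reduction C sh p \<Phi>)"

definition minimal_global_model ::
    "'x topology \<Rightarrow> ('x set \<Rightarrow> 'k::field set) \<Rightarrow> nat \<Rightarrow> 'x set \<Rightarrow> 'k P1_map \<Rightarrow> 'k list \<Rightarrow> bool"
  where
  "minimal_global_model C sh d S \<phi> v \<longleftrightarrow>
     S \<subseteq> topspace C \<and> openin C (topspace C - S) \<and>
     (\<exists>\<Phi>. presentation d \<phi> \<Phi> \<and> v \<in> \<Phi>) \<and>
     set v \<subseteq> sh (topspace C - S) \<and>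
     (\<forall>p \<in> closed_points C - S.
        min_resultant C sh d \<phi> p = val C sh p (resultant_form d v))"

end

theory Submission
  imports Defs
begin

text \<open>
  At a closed point, if only one of \<open>l1\<close>, \<open>l2\<close> had a pole, the reduction would be \<open>[XY : 0]\<close> or
  \<open>[0 : XY]\<close>, which is unstable; this gives the equality of the poles.  Where both are regular, the
  given model has minimal valuation \<open>0\<close>, and conjugating by \<open>\<Gamma>\<close> multiplies its resultant by
  \<open>det \<Gamma> ^ 6\<close>.  So it must be shown that the conjugate has minimal valuation at most
  \<open>3/2 v (det \<Gamma>)\<close>.  Up to a unimodular matrix on the right, \<open>\<Gamma>\<close> is \<open>U diag(g, k)\<close> with \<open>U\<close> unimodular
  and \<open>v g \<le> v k\<close>; if the bound failed, the reduction of the model conjugated by \<open>U\<close> would have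
  \<open>a0 = b0 = b1 = 0\<close>.  This happens only if \<open>l1 = l2 = 1\<close> in the residue field, a case that is
  unstable and hence excluded.  Regularity of \<open>l1\<close> and \<open>l2\<close> off the poles follows by gluing, since
  every non-closed point is generic.
\<close>

section \<open>Homomorphisms and explicit formulas\<close>

lemma ring_of_type_algebra_simps [simp]:
  fixes x y :: "'a::ring_1"
  shows "carrier (ring_of_type_algebra :: 'a ring) = UNIV"
    and "\<zero>\<^bsub>(ring_of_type_algebra :: 'a ring)\<^esub> = 0"
    and "\<one>\<^bsub>(ring_of_type_algebra :: 'a ring)\<^esub> = 1"
    and "x \<otimes>\<^bsub>ring_of_type_algebra\<^esub> y = x * y"
    and "x \<oplus>\<^bsub>ring_of_type_algebra\<^esub> y = x + y"
  by (auto simp: ring_of_type_algebra_def)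

lemma subring_of_simps [simp]:
  "carrier (subring_of A) = A"
  "\<zero>\<^bsub>subring_of A\<^esub> = 0"
  "\<one>\<^bsub>subring_of A\<^esub> = 1"
  "x \<otimes>\<^bsub>subring_of A\<^esub> y = x * y"
  "x \<oplus>\<^bsub>subring_of A\<^esub> y = x + y"
  by (auto simp: subring_of_def)

lemma a_inv_type_algebra [simp]: "\<ominus>\<^bsub>ring_of_type_algebra\<^esub> x = - x" for x :: "'a::comm_ring_1"
proof -
  interpret cring "ring_of_type_algebra :: 'a ring" by (rule cring_from_type_algebra)
  show ?thesis by (rule minus_equality) auto
qed

lemma a_minus_type_algebra [simp]: "x \<ominus>\<^bsub>ring_of_type_algebra\<^esub> y = x - y" for x :: "'a::comm_ring_1"
  by (simp add: a_minus_def)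

lemma nat_pow_type_algebra [simp]: "x [^]\<^bsub>ring_of_type_algebra\<^esub> (n::nat) = x ^ n"
  for x :: "'a::comm_ring_1"
proof -
  interpret cring "ring_of_type_algebra :: 'a ring" by (rule cring_from_type_algebra)
  show ?thesis by (induction n) (auto simp: mult.commute)
qed

lemma add_pow_type_algebra [simp]: "add_pow ring_of_type_algebra (n::nat) x = of_nat n * x"
  for x :: "'a::comm_ring_1"
proof -
  interpret cring "ring_of_type_algebra :: 'a ring" by (rule cring_from_type_algebra)
  show ?thesis by (induction n) (auto simp: algebra_simps)
qed

lemma finsum_type_algebra [simp]:
  fixes f :: "'b \<Rightarrow> 'a::comm_ring_1"
  assumes "finite I"
  shows "finsum ring_of_type_algebra f I = sum f I"
proof -
  interpret cring "ring_of_type_algebra :: 'a ring" by (rule cring_from_type_algebra)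
  show ?thesis using assms by (induction rule: finite_induct) auto
qed

section \<open>Conjugation of models under ring homomorphisms\<close>

lemma (in ring_hom_cring) hom_add_pow:
  "x \<in> carrier R \<Longrightarrow> h (add_pow R (n::nat) x) = add_pow S n (h x)"
  by (induction n) auto

lemma (in ring_hom_cring) hom_form_subst:
  assumes "{\<alpha>, \<beta>, \<gamma>, \<delta>} \<subseteq> carrier R" "set c \<subseteq> carrier R" "length c = d + 1"
  shows "map h (form_subst R d (\<alpha>, \<beta>, \<gamma>, \<delta>) c) = form_subst S d (h \<alpha>, h \<beta>, h \<gamma>, h \<delta>) (map h c)"
proof -
  have c: "c ! i \<in> carrier R" if "i \<le> d" for i
    using assms that nth_mem[of i c] by auto
  show ?thesis
    unfolding form_subst_def using assms(1,3)
    by (auto simp: hom_finsum Pi_def hom_add_pow c intro!: S.finsum_cong')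
qed

lemma (in cring) form_subst_closed:
  assumes "{\<alpha>, \<beta>, \<gamma>, \<delta>} \<subseteq> carrier R" "set c \<subseteq> carrier R" "length c = d + 1" "j \<le> d"
  shows "form_subst R d (\<alpha>, \<beta>, \<gamma>, \<delta>) c ! j \<in> carrier R"
proof -
  have c: "c ! i \<in> carrier R" if "i \<le> d" for i
    using assms that nth_mem[of i c] by auto
  show ?thesis
    unfolding form_subst_def using assms(1,3,4)
    by (auto simp: Pi_def c simp del: upt_Suc intro!: finsum_closed)
qed

lemma length_form_subst [simp]: "length (form_subst R d \<Gamma> c) = d + 1"
  by (cases \<Gamma>) (simp add: form_subst_def)

text \<open>Conjugated coordinates are integer polynomials in the matrix entries and the old
  coordinates, so ring homomorphisms respect them. This carries a computation in the function field
  to the local ring and on to the algebraic closure of the residue field.\<close>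

lemma (in ring_hom_cring) hom_conj_model:
  assumes "{\<alpha>, \<beta>, \<gamma>, \<delta>} \<subseteq> carrier R" "set v \<subseteq> carrier R" "length v = 2 * d + 2"
  shows "map h (conj_model R d (\<alpha>, \<beta>, \<gamma>, \<delta>) v) = conj_model S d (h \<alpha>, h \<beta>, h \<gamma>, h \<delta>) (map h v)"
proof -
  define A B where "A = form_subst R d (\<alpha>, \<beta>, \<gamma>, \<delta>) (Fa d v)"
    and "B = form_subst R d (\<alpha>, \<beta>, \<gamma>, \<delta>) (Fb d v)"
  have F: "set (Fa d v) \<subseteq> carrier R" "set (Fb d v) \<subseteq> carrier R"
      "length (Fa d v) = d + 1" "length (Fb d v) = d + 1"
    using assms(2,3) set_take_subset[of "d + 1" v] set_drop_subset[of "d + 1" v]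
    by (auto simp: Fa_def Fb_def)
  have hF: "Fa d (map h v) = map h (Fa d v)" "Fb d (map h v) = map h (Fb d v)"
    by (simp_all add: Fa_def Fb_def take_map drop_map)
  have A: "form_subst S d (h \<alpha>, h \<beta>, h \<gamma>, h \<delta>) (Fa d (map h v)) = map h A"
   and B: "form_subst S d (h \<alpha>, h \<beta>, h \<gamma>, h \<delta>) (Fb d (map h v)) = map h B"
    unfolding A_def B_def hF using hom_form_subst F assms(1) by metis+
  have len: "length A = d + 1" "length B = d + 1"
    by (simp_all add: A_def B_def)
  have cl: "A ! j \<in> carrier R" "B ! j \<in> carrier R" if "j \<le> d" for j
    unfolding A_def B_def using R.form_subst_closed F assms(1) that by metis+
  show ?thesis
    unfolding conj_model_def prod.case Let_def A B A_def[symmetric] B_def[symmetric]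
    using assms(1) cl len by (auto simp: a_minus_def simp del: upt_Suc)
qed

section \<open>Explicit conjugation and resultants in degree 2\<close>

lemma conj_model_2:
  fixes \<alpha> \<beta> \<gamma> \<delta> :: "'a::comm_ring_1"
  shows "conj_model ring_of_type_algebra 2 (\<alpha>, \<beta>, \<gamma>, \<delta>) [a0, a1, a2, b0, b1, b2] =
   (let A0 = a0 * \<alpha>^2 + a1 * \<alpha> * \<gamma> + a2 * \<gamma>^2;
        A1 = 2 * a0 * \<alpha> * \<beta> + a1 * (\<alpha> * \<delta> + \<beta> * \<gamma>) + 2 * a2 * \<gamma> * \<delta>;
        A2 = a0 * \<beta>^2 + a1 * \<beta> * \<delta> + a2 * \<delta>^2;
        B0 = b0 * \<alpha>^2 + b1 * \<alpha> * \<gamma> + b2 * \<gamma>^2;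
        B1 = 2 * b0 * \<alpha> * \<beta> + b1 * (\<alpha> * \<delta> + \<beta> * \<gamma>) + 2 * b2 * \<gamma> * \<delta>;
        B2 = b0 * \<beta>^2 + b1 * \<beta> * \<delta> + b2 * \<delta>^2
    in [\<delta> * A0 - \<beta> * B0, \<delta> * A1 - \<beta> * B1, \<delta> * A2 - \<beta> * B2,
        \<alpha> * B0 - \<gamma> * A0, \<alpha> * B1 - \<gamma> * A1, \<alpha> * B2 - \<gamma> * A2])"
  by (simp add: conj_model_def form_subst_def Let_def Fa_def Fb_def numeral_2_eq_2 atMost_Suc algebra_simps
       power2_eq_square)

text \<open>Substitutions compose and the adjugate reverses products, so this is a right action.
  Column operations on a matrix are thus further conjugations.\<close>

lemma conj_model_2_comp:
  fixes \<alpha> \<beta> \<gamma> \<delta> :: "'a::comm_ring_1"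
  assumes "length v = 6"
  shows "conj_model ring_of_type_algebra 2 (\<alpha>', \<beta>', \<gamma>', \<delta>')
      (conj_model ring_of_type_algebra 2 (\<alpha>, \<beta>, \<gamma>, \<delta>) v) =
    conj_model ring_of_type_algebra 2
      (\<alpha> * \<alpha>' + \<beta> * \<gamma>', \<alpha> * \<beta>' + \<beta> * \<delta>', \<gamma> * \<alpha>' + \<delta> * \<gamma>', \<gamma> * \<beta>' + \<delta> * \<delta>') v"
proof -
  obtain a0 a1 a2 b0 b1 b2 where v: "v = [a0, a1, a2, b0, b1, b2]"
    using assms by (auto simp: eval_nat_numeral length_Suc_conv)
  show ?thesis unfolding v conj_model_2 Let_def
    by (simp add: power2_eq_square algebra_simps)
qed

lemma det_2:
  assumes "A \<in> carrier_mat 2 2"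
  shows "Determinant.det A = A $$ (0,0) * A $$ (1,1) - A $$ (0,1) * A $$ (1,0)"
  using assms
  by (subst laplace_expansion_row[OF assms, of 0])
     (auto simp: numeral_2_eq_2 cofactor_def det_single mat_delete_def)

lemma det_3:
  assumes "A \<in> carrier_mat 3 3"
  shows "Determinant.det A =
    A $$ (0,0) * (A $$ (1,1) * A $$ (2,2) - A $$ (1,2) * A $$ (2,1))
    - A $$ (0,1) * (A $$ (1,0) * A $$ (2,2) - A $$ (1,2) * A $$ (2,0))
    + A $$ (0,2) * (A $$ (1,0) * A $$ (2,1) - A $$ (1,1) * A $$ (2,0))"
  using assms
  by (subst laplace_expansion_row[OF assms, of 0])
     (auto simp: numeral_3_eq_3 numeral_2_eq_2 cofactor_def det_2[unfolded numeral_2_eq_2] mat_delete_def algebra_simps)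

lemma resultant_form_2:
  "resultant_form 2 [a0, a1, a2, b0, b1, b2] =
     (a0 * b2 - a2 * b0)^2 - (a0 * b1 - a1 * b0) * (a1 * b2 - a2 * b1)"
proof -
  define S where "S = sylvester_mat_sub 2 2 (Poly [a2, a1, a0]) (Poly [b2, b1, b0])"
  have S: "S \<in> carrier_mat 4 4"
    unfolding S_def using sylvester_mat_sub_carrier[of 2 2] by (simp add: numeral_Bit0)
  have cf: "coeff [:z, y, x:] n = (if n = 0 then z else if n = 1 then y else if n = 2 then x else 0)"
    for x y z :: 'a and n
    by (auto simp: coeff_pCons numeral_2_eq_2 split: nat.splits)
  have idx: "S $$ (i, j) = (if i < 2 then
       if i \<le> j \<and> j - i \<le> 2 then coeff (Poly [a2, a1, a0]) (2 + i - j) else 0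
     else if i - 2 \<le> j \<and> j \<le> i then coeff (Poly [b2, b1, b0]) (i-j) else 0)" if "i < 4" "j < 4" for i j
    unfolding S_def using that by (subst sylvester_mat_sub_index) auto
  have md: "mat_delete S 0 j \<in> carrier_mat 3 3" if "j < 4" for j
    using mat_delete_carrier[OF S] by simp
  have del: "mat_delete S 0 j $$ (i, k) = S $$ (Suc i, if k < j then k else Suc k)"
    if "i < 3" "k < 3" "j < 4" for i j k
    using that S by (simp add: mat_delete_def)
  have "Determinant.det S = (\<Sum>j<4. S $$ (0, j) * cofactor S 0 j)"
    by (rule laplace_expansion_row[OF S]) simp
  \<comment> \<open>The last entry of the first row is zero, since a row carries only three
    coefficients.\<close>
  also have "\<dots> = a0 * cofactor S 0 0 + a1 * cofactor S 0 1 + a2 * cofactor S 0 2"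
  proof -
    have "{..<4} = {0, 1, 2, 3 :: nat}" by auto
    then show ?thesis by (simp add: idx cf)
  qed
  also have "\<dots> = (a0 * b2 - a2 * b0)^2 - (a0 * b1 - a1 * b0) * (a1 * b2 - a2 * b1)"
    by (simp add: cofactor_def det_3[OF md] del idx cf algebra_simps power2_eq_square)
  finally show ?thesis
    by (simp add: resultant_form_def Fa_def Fb_def S_def)
qed

text \<open>With \<open>D\<close> the determinant, the substitution and the adjugate each multiply
  the minors by \<open>D\<close>, which gives \<open>D ^ 4\<close> because the resultant is
  quadratic in them. The substitution also changes variables in the quadratic form that they define,
  and its discriminant contributes \<open>D ^ 2\<close>.\<close>

lemma resultant_form_conj_2:
  assumes "length v = 6"
  shows "resultant_form 2 (conj_model ring_of_type_algebra 2 (\<alpha>, \<beta>, \<gamma>, \<delta>) v) =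
    (\<alpha> * \<delta> - \<beta> * \<gamma>) ^ 6 * resultant_form 2 v"
proof -
  obtain a0 a1 a2 b0 b1 b2 where v: "v = [a0, a1, a2, b0, b1, b2]"
    using assms by (auto simp: eval_nat_numeral length_Suc_conv)
  define D where "D = \<alpha> * \<delta> - \<beta> * \<gamma>"
  define A0 where "A0 = a0 * \<alpha>^2 + a1 * \<alpha> * \<gamma> + a2 * \<gamma>^2"
  define A1 where "A1 = 2 * a0 * \<alpha> * \<beta> + a1 * (\<alpha> * \<delta> + \<beta> * \<gamma>) + 2 * a2 * \<gamma> * \<delta>"
  define A2 where "A2 = a0 * \<beta>^2 + a1 * \<beta> * \<delta> + a2 * \<delta>^2"
  define B0 where "B0 = b0 * \<alpha>^2 + b1 * \<alpha> * \<gamma> + b2 * \<gamma>^2"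
  define B1 where "B1 = 2 * b0 * \<alpha> * \<beta> + b1 * (\<alpha> * \<delta> + \<beta> * \<gamma>) + 2 * b2 * \<gamma> * \<delta>"
  define B2 where "B2 = b0 * \<beta>^2 + b1 * \<beta> * \<delta> + b2 * \<delta>^2"
  define p q r where "p = a0 * b1 - a1 * b0" and "q = a0 * b2 - a2 * b0" and "r = a1 * b2 - a2 * b1"
  \<comment> \<open>The resultant is the discriminant of a quadratic form in the \<open>2 \<times> 2\<close> minors.\<close>
  have minors: "A0 * B1 - A1 * B0 = D * (p * \<alpha>^2 + 2 * q * \<alpha> * \<gamma> + r * \<gamma>^2)"
    "A0 * B2 - A2 * B0 = D * (p * \<alpha> * \<beta> + q * (\<alpha> * \<delta> + \<beta> * \<gamma>) + r * \<gamma> * \<delta>)"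
    "A1 * B2 - A2 * B1 = D * (p * \<beta>^2 + 2 * q * \<beta> * \<delta> + r * \<delta>^2)"
    unfolding A0_def A1_def A2_def B0_def B1_def B2_def p_def q_def r_def D_def
    by (simp_all add: power2_eq_square algebra_simps)
  have adj: "(\<delta> * x - \<beta> * y) * (\<alpha> * y' - \<gamma> * x') - (\<delta> * x' - \<beta> * y') * (\<alpha> * y - \<gamma> * x) = D * (x * y' - x' * y)"
    for x y x' y'
    unfolding D_def by (simp add: algebra_simps)
  have "resultant_form 2 (conj_model ring_of_type_algebra 2 (\<alpha>, \<beta>, \<gamma>, \<delta>) v) =
    (D * (A0 * B2 - A2 * B0))^2 - (D * (A0 * B1 - A1 * B0)) * (D * (A1 * B2 - A2 * B1))"
    unfolding v conj_model_2 Let_def resultant_form_2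
      A0_def[symmetric] A1_def[symmetric] A2_def[symmetric] B0_def[symmetric] B1_def[symmetric] B2_def[symmetric]
    by (simp only: adj)
  also have "\<dots> = D^4 * ((p * \<alpha> * \<beta> + q * (\<alpha> * \<delta> + \<beta> * \<gamma>) + r * \<gamma> * \<delta>)^2
      - (p * \<alpha>^2 + 2 * q * \<alpha> * \<gamma> + r * \<gamma>^2) * (p * \<beta>^2 + 2 * q * \<beta> * \<delta> + r * \<delta>^2))"
    unfolding minors by (simp add: power_def algebra_simps eval_nat_numeral)
  also have "\<dots> = D^4 * (D^2 * (q^2 - p * r))"
    unfolding D_def by (rule arg_cong[where f = "(*) _"]) (simp add: power2_eq_square algebra_simps)
  also have "\<dots> = D^6 * (q^2 - p * r)"
    by (simp add: mult.assoc[symmetric] power_add[symmetric])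
  finally show ?thesis
    unfolding v resultant_form_2 D_def p_def q_def r_def by simp
qed

section \<open>Discrete valuations\<close>

lemma domain_subring_of:
  fixes A :: "'k::field set"
  assumes "subring A ring_of_type_algebra"
  shows "domain (subring_of A)"
proof -
  interpret field "ring_of_type_algebra :: 'k ring" by (rule field_from_type_algebra)
  show ?thesis unfolding subring_of_def by (rule subring_is_domain[OF assms])
qed

lemma Units_subring_of: "Units (subring_of A) = {u \<in> A. u \<noteq> 0 \<and> inverse u \<in> A}"
proof (intro equalityI subsetI)
  fix u assume "u \<in> Units (subring_of A)"
  then obtain w where "u \<in> A" "w \<in> A" "w * u = 1" by (auto simp: Units_def)
  moreover from this have "inverse u = w" using inverse_unique[of u w] by (simp add: mult.commute)
  ultimately show "u \<in> {u \<in> A. u \<noteq> 0 \<and> inverse u \<in> A}" by auto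
next
  fix u assume "u \<in> {u \<in> A. u \<noteq> 0 \<and> inverse u \<in> A}"
  then show "u \<in> Units (subring_of A)"
    by (auto simp: Units_def intro!: bexI[of _ "inverse u"])
qed

lemma PIdl_subring_of: "PIdl\<^bsub>subring_of A\<^esub> a = {x * a | x. x \<in> A}"
  by (simp add: cgenideal_def)

text \<open>An irreducible element generates the only maximal ideal, so any two of them are
  associated, and a factorization into irreducibles collapses to a unit times a power of one of
  them.\<close>

lemma dvr_uniformizer:
  fixes A :: "'k::field set"
  assumes sub: "subring A ring_of_type_algebra" and dvr: "discrete_valuation_ring (subring_of A)"
  obtains t where "t \<in> A" "t \<noteq> 0" "t \<notin> Units (subring_of A)"
    "A - Units (subring_of A) = PIdl\<^bsub>subring_of A\<^esub> t"
    "maximalideal (PIdl\<^bsub>subring_of A\<^esub> t) (subring_of A)"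
    "\<And>x. x \<in> A \<Longrightarrow> x \<noteq> 0 \<Longrightarrow> \<exists>u\<in>Units (subring_of A). \<exists>n::nat. x = u * t ^ n"
proof -
  let ?R = "subring_of A"
  interpret principal_domain ?R
    using dvr by (simp add: discrete_valuation_ring_def)
  have uniq: "M = N" if "maximalideal M ?R" "maximalideal N ?R" for M N
    using dvr that by (auto simp: discrete_valuation_ring_def)
  have "\<not> field ?R"
    using dvr by (simp add: discrete_valuation_ring_def)
  then obtain y where y: "y \<in> carrier ?R - {\<zero>\<^bsub>?R\<^esub>}" "y \<notin> Units ?R"
    using cring_fieldI by (auto simp: Units_subring_of)
  obtain t where t: "t \<in> carrier ?R" "ring_irreducible\<^bsub>?R\<^esub> t"
    using exists_irreducible_divisor[OF y] by blast
  have tU: "t \<notin> Units ?R" and t0: "t \<noteq> 0"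
    using ring_irreducibleE[OF t] by auto
  have pow_closed: "t ^ m \<in> A" for m
    using t one_closed m_closed by (induction m) auto
  have irr: "\<exists>u\<in>Units ?R. b = u * t" if b: "b \<in> carrier ?R" "ring_irreducible\<^bsub>?R\<^esub> b" for b
  proof -
    have "PIdl\<^bsub>?R\<^esub> b = PIdl\<^bsub>?R\<^esub> t"
      using uniq irreducible_imp_maximalideal t b by blast
    then have "b \<in> PIdl\<^bsub>?R\<^esub> t"
      using cgenideal_self[OF b(1)] by simp
    then obtain u where u: "u \<in> A" "b = u * t"
      by (auto simp: PIdl_subring_of)
    then show ?thesis
      using ring_irreducibleE(5)[OF b, of u t] t tU by auto
  qed
  have mult_eq: "(\<otimes>\<^bsub>?R\<^esub>) = (*)"
    by (simp add: fun_eq_iff)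
  have unit_mult: "u * w \<in> Units ?R" if "u \<in> Units ?R" "w \<in> Units ?R" for u w
    using Units_m_closed[OF that] by simp
  have fac: "\<exists>u\<in>Units ?R. \<exists>n::nat. x = u * t ^ n" if x: "x \<in> A" "x \<noteq> 0" for x
  proof (cases "x \<in> Units ?R")
    case True
    then show ?thesis by (intro bexI[of _ x] exI[of _ 0]) auto
  next
    case False
    then obtain fs where fs: "set fs \<subseteq> carrier (mult_of ?R)" "wfactors (mult_of ?R) fs x"
      using factorization_property[of x] x by auto
    have prod: "\<exists>u\<in>Units ?R. \<exists>n::nat. foldr (\<otimes>\<^bsub>mult_of ?R\<^esub>) fs \<one>\<^bsub>mult_of ?R\<^esub> = u * t ^ n"
      using fs(1) fs(2)[unfolded wfactors_def, THEN conjunct1]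
    proof (induction fs)
      case Nil
      then show ?case by (intro bexI[of _ 1] exI[of _ 0]) (use Units_one_closed in auto)
    next
      case (Cons f fs)
      then obtain u n where u: "u \<in> Units ?R" "foldr (\<otimes>\<^bsub>mult_of ?R\<^esub>) fs \<one>\<^bsub>mult_of ?R\<^esub> = u * t ^ n"
        by (auto simp: mult_eq)
      have "ring_irreducible\<^bsub>?R\<^esub> f"
        using Cons.prems by (intro ring_irreducibleI') auto
      then obtain w where w: "w \<in> Units ?R" "f = w * t"
        using irr[of f] Cons.prems by auto
      show ?case
        by (intro bexI[of _ "w * u"] exI[of _ "Suc n"]) (use u w unit_mult in \<open>auto simp: algebra_simps mult_eq\<close>)
    qed
    then obtain u n where u: "u \<in> Units ?R" "foldr (\<otimes>\<^bsub>mult_of ?R\<^esub>) fs \<one>\<^bsub>mult_of ?R\<^esub> = u * t ^ n"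
      by auto
    have unz: "u * t ^ n \<in> carrier ?R - {\<zero>\<^bsub>?R\<^esub>}"
      using u t t0 by (auto simp: Units_subring_of pow_closed m_closed[simplified])
    \<comment> \<open>\<open>wfactors\<close> fixes the product only up to associates, so one more
      unit has to be absorbed.\<close>
    have "u * t ^ n \<sim>\<^bsub>mult_of ?R\<^esub> x"
      using fs(2)[unfolded wfactors_def] unfolding u by blast
    then have "u * t ^ n \<sim>\<^bsub>?R\<^esub> x"
      using assoc_iff_assoc_mult[of "u * t ^ n" x] unz x by simp
    then have "x \<sim>\<^bsub>?R\<^esub> u * t ^ n"
      unfolding associated_def by blast
    then obtain w where w: "w \<in> Units ?R" "x = w * (u * t ^ n)"
      using ring_associated_iff[of x "u * t ^ n"] x unz by auto
    then show ?thesis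
      by (intro bexI[of _ "w * u"] exI[of _ n]) (use u unit_mult in auto)
  qed
  have "A - Units ?R = PIdl\<^bsub>?R\<^esub> t"
  proof (intro equalityI subsetI)
    fix x assume x: "x \<in> A - Units ?R"
    show "x \<in> PIdl\<^bsub>?R\<^esub> t"
    proof (cases "x = 0")
      case True
      then show ?thesis using zero_closed by (auto simp: PIdl_subring_of intro!: exI[of _ 0])
    next
      case False
      then obtain u and n :: nat where u: "u \<in> Units ?R" "x = u * t ^ n"
        using fac x by blast
      then obtain m where "n = Suc m"
        using x by (cases n) auto
      then show ?thesis
        using u m_closed[of u "t ^ m"] pow_closed[of m] by (auto simp: PIdl_subring_of Units_def intro!: exI[of _ "u * t ^ m"])
    qed
  next
    fix x assume "x \<in> PIdl\<^bsub>?R\<^esub> t"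
    then obtain a where a: "a \<in> A" "x = a * t" by (auto simp: PIdl_subring_of)
    then have "x \<in> A" using m_closed t by simp
    moreover have "x \<notin> Units ?R"
    proof
      assume "x \<in> Units ?R"
      then have "a * inverse x \<in> A" "a \<noteq> 0"
        using m_closed[of a "inverse x"] a by (auto simp: Units_subring_of)
      then have "inverse t \<in> A"
        using a t0 by (simp add: field_simps)
      then show False using tU t0 t by (simp add: Units_subring_of)
    qed
    ultimately show "x \<in> A - Units ?R" by simp
  qed
  then show thesis
    using that t t0 tU fac irreducible_imp_maximalideal by simp
qed

lemma maximalideal_max_ideal:
  fixes sh :: "'x set \<Rightarrow> 'k::field set"
  assumes "subring (stalk C sh p) ring_of_type_algebra"
    and "discrete_valuation_ring (local_ring C sh p)"
  shows "maximalideal (max_ideal C sh p) (local_ring C sh p)"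
  using dvr_uniformizer[OF assms] unfolding max_ideal_def by metis

section \<open>Abstract discrete valuations\<close>

locale discrete_val =
  fixes v :: "'k::field \<Rightarrow> int"
  assumes v_mult: "x \<noteq> 0 \<Longrightarrow> y \<noteq> 0 \<Longrightarrow> v (x * y) = v x + v y"
    and v_add: "x \<noteq> 0 \<Longrightarrow> y \<noteq> 0 \<Longrightarrow> x + y \<noteq> 0 \<Longrightarrow> min (v x) (v y) \<le> v (x + y)"
begin

definition ge :: "int \<Rightarrow> 'k \<Rightarrow> bool" where
  "ge n x \<longleftrightarrow> x = 0 \<or> n \<le> v x"

lemma v_one [simp]: "v 1 = 0"
  using v_mult[of 1 1] by simp

lemma v_power: "x \<noteq> 0 \<Longrightarrow> v (x ^ n) = int n * v x"
  by (induction n) (auto simp: v_mult algebra_simps)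

lemma v_uminus [simp]: "v (- x) = v x"
proof (cases "x = 0")
  case False
  have "v (-1) + v (-1) = v ((-1) * (-1))" by (rule v_mult[symmetric]) auto
  then have "v (-1) = 0" by simp
  then show ?thesis using v_mult[of "-1" x] False by simp
qed simp

lemma v_inverse: "x \<noteq> 0 \<Longrightarrow> v (inverse x) = - v x"
  using v_mult[of x "inverse x"] by simp

lemma v_divide: "x \<noteq> 0 \<Longrightarrow> y \<noteq> 0 \<Longrightarrow> v (x / y) = v x - v y"
  by (simp add: divide_inverse v_mult v_inverse)

lemma ge_0 [simp]: "ge n 0"
  by (simp add: ge_def)

lemma ge_one [simp]: "ge n 1 \<longleftrightarrow> n \<le> 0"
  by (simp add: ge_def)

lemma ge_mono: "ge n x \<Longrightarrow> m \<le> n \<Longrightarrow> ge m x"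
  by (auto simp: ge_def)

lemma ge_uminus [simp]: "ge n (- x) \<longleftrightarrow> ge n x"
  by (auto simp: ge_def)

lemma ge_add: "ge n x \<Longrightarrow> ge n y \<Longrightarrow> ge n (x + y)"
  using v_add[of x y] by (cases "x = 0"; cases "y = 0"; cases "x + y = 0") (auto simp: ge_def)

lemma ge_diff: "ge n x \<Longrightarrow> ge n y \<Longrightarrow> ge n (x - y)"
  using ge_add[of n x "- y"] by simp

lemma ge_mult: "ge m x \<Longrightarrow> ge n y \<Longrightarrow> ge (m + n) (x * y)"
  by (auto simp: ge_def v_mult)

lemma ge_0_mult: "ge 0 x \<Longrightarrow> ge n y \<Longrightarrow> ge n (x * y)"
  using ge_mult[of 0 x n y] by simp

lemma ge_mult_left_iff: "x \<noteq> 0 \<Longrightarrow> ge n (x * y) \<longleftrightarrow> ge (n - v x) y"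
  by (auto simp: ge_def v_mult)

end

text \<open>Fractions of elements \<open>u * t ^ n\<close> exhaust the field, so every nonzero
  element is a unit times an integral power of \<open>t\<close>. The exponent does not depend on the
  generator \<open>t\<close>, so the definite description in \<open>val\<close> is proper.\<close>

lemma discrete_val_val:
  fixes C :: "'x topology" and sh :: "'x set \<Rightarrow> 'k::field set"
  assumes sub: "subring (stalk C sh p) ring_of_type_algebra"
    and dvr: "discrete_valuation_ring (local_ring C sh p)"
    and frac: "\<And>x. \<exists>a\<in>stalk C sh p. \<exists>b\<in>stalk C sh p. b \<noteq> 0 \<and> x = a / b"
  shows "discrete_val (val C sh p)"
    and "stalk C sh p = {x. discrete_val.ge (val C sh p) 0 x}"
    and "max_ideal C sh p = {x. discrete_val.ge (val C sh p) 1 x}"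
proof -
  define A where "A = stalk C sh p"
  define U where "U = Units (subring_of A)"
  obtain t where t: "t \<in> A" "t \<noteq> 0" "t \<notin> U" "max_ideal C sh p = PIdl\<^bsub>subring_of A\<^esub> t"
    and fac: "\<And>x. x \<in> A \<Longrightarrow> x \<noteq> 0 \<Longrightarrow> \<exists>u\<in>U. \<exists>n::nat. x = u * t ^ n"
    using dvr_uniformizer[OF sub dvr] unfolding A_def U_def max_ideal_def by metis
  note A = subringE[OF sub, folded A_def, simplified]
  have U: "u \<in> U \<longleftrightarrow> u \<in> A \<and> u \<noteq> 0 \<and> inverse u \<in> A" for u
    by (auto simp: U_def Units_subring_of)
  have U_mult: "u * w \<in> U" and U_div: "u / w \<in> U" if "u \<in> U" "w \<in> U" for u w
    using that A(6) by (auto simp: U divide_inverse)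
  have pow_A: "x ^ n \<in> A" if "x \<in> A" for x n
    using that A by (induction n) auto
  have pow_U: "x ^ n \<in> U" if "x \<in> U" for x n
    using that pow_A by (auto simp: U simp flip: power_inverse)
  have powi_U: "x powi n \<in> U" if "x \<in> U" for x n
    using pow_U[of x] pow_U[of "inverse x"] that by (auto simp: power_int_def U)
  have ex: "\<exists>u\<in>U. \<exists>n. x = u * t powi n" if x0: "x \<noteq> 0" for x
  proof -
    obtain a b where ab: "a \<in> A" "b \<in> A" "b \<noteq> 0" "x = a / b" using frac[of x] A_def by auto
    then obtain u w m n where "u \<in> U" "a = u * t ^ m" "w \<in> U" "b = w * t ^ n"
      using fac[of a] fac[of b] x0 by (metis divide_eq_0_iff)
    then show ?thesis
      using t U_div ab x0
      by (intro bexI[of _ "u / w"] exI[of _ "int m - int n"]) (auto simp: power_int_diff)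
  qed
  have in_A: "u * t powi n \<in> A \<longleftrightarrow> 0 \<le> n" if u: "u \<in> U" for u n
  proof
    assume "0 \<le> n"
    then show "u * t powi n \<in> A"
      using u t pow_A A(6) by (auto simp: power_int_def U)
  next
    assume uA: "u * t powi n \<in> A"
    show "0 \<le> n"
    proof (rule ccontr)
      assume "\<not> 0 \<le> n"
      then have n: "n = - int (Suc k)" if "k = nat (- n - 1)" for k
        using that by simp
      \<comment> \<open>With this \<open>k\<close>, \<open>n = - (k + 1)\<close>; multiplying by
        \<open>t ^ k\<close> leaves exactly \<open>inverse t\<close>, which is not in
        \<open>A\<close>.\<close>
      define k where "k = nat (- n - 1)"
      have "inverse u * (u * t powi n) * t ^ k \<in> A"
        using uA u t pow_A A(6) by (auto simp: U)
      also have "inverse u * (u * t powi n) * t ^ k = t powi n * t ^ k"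
        using u by (simp add: U)
      also have "t powi n = inverse (t ^ Suc k)"
        by (simp only: n[OF k_def] power_int_minus power_int_of_nat)
      also have "inverse (t ^ Suc k) * t ^ k = inverse t"
        using t(2) by simp
      finally show False using t by (simp add: U)
    qed
  qed
  have val: "val C sh p (u * t powi n) = n" if u: "u \<in> U" for u n
    unfolding val_def
  proof (rule the_equality)
    show "\<exists>t'\<in>stalk C sh p. \<exists>u'\<in>Units (local_ring C sh p).
        max_ideal C sh p = PIdl\<^bsub>local_ring C sh p\<^esub> t' \<and> u * t powi n = u' * t' powi n"
      using t u unfolding A_def U_def by blast
  next
    fix m
    assume "\<exists>t'\<in>stalk C sh p. \<exists>u'\<in>Units (local_ring C sh p).
        max_ideal C sh p = PIdl\<^bsub>local_ring C sh p\<^esub> t' \<and> u * t powi n = u' * t' powi m"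
    then obtain t' u' where t': "t' \<in> A" "u' \<in> U" "PIdl\<^bsub>subring_of A\<^esub> t = PIdl\<^bsub>subring_of A\<^esub> t'"
        "u * t powi n = u' * t' powi m"
      using t(4) unfolding A_def U_def by metis
    have self: "x \<in> PIdl\<^bsub>subring_of A\<^esub> x" for x
      using A(3) by (auto simp: PIdl_subring_of intro: exI[of _ 1])
    \<comment> \<open>Two generators differ by a unit \<open>b\<close>. Hence
      \<open>t powi (n - m)\<close> and its inverse both lie in \<open>A\<close>, and
      \<open>in_A\<close> leaves only \<open>m = n\<close>.\<close>
    have "t \<in> PIdl\<^bsub>subring_of A\<^esub> t'" "t' \<in> PIdl\<^bsub>subring_of A\<^esub> t"
      using self[of t] self[of t'] t'(3) by auto
    then obtain a b where ab: "a \<in> A" "b \<in> A" "t = a * t'" "t' = b * t"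
      unfolding PIdl_subring_of by blast
    have "a * b * t = 1 * t"
      using ab(3)[symmetric] ab(4)[symmetric] by (simp add: mult.assoc)
    then have "a * b = 1" using t(2) by (simp only: mult_cancel_right) simp
    then have "inverse b = a" "b \<noteq> 0" using inverse_unique[of b a] by (auto simp: mult.commute)
    then have b: "b \<in> U" using ab by (simp add: U)
    define w where "w = (u' * b powi m) / u"
    have w: "w \<in> U" unfolding w_def using U_mult U_div powi_U b t' u by blast
    have eq: "t powi n = w * t powi m"
      using t'(4) ab(4) u by (simp add: w_def power_int_mult_distrib U field_simps)
    have "t powi (n - m) = w" 
      using eq t(2) by (simp add: power_int_diff)
    moreover have "t powi (m - n) = inverse w"
      using eq t(2) w by (simp add: power_int_diff U inverse_eq_divide)
    ultimately have "1 * t powi (n - m) \<in> A" "1 * t powi (m - n) \<in> A" "1 \<in> U"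
      using w A(3) by (auto simp: U)
    then show "m = n" using in_A by force
  qed
  show dv: "discrete_val (val C sh p)"
  proof
    fix x y :: 'k assume xy: "x \<noteq> 0" "y \<noteq> 0"
    obtain u m where u: "u \<in> U" "x = u * t powi m" using ex xy by metis
    obtain w n where w: "w \<in> U" "y = w * t powi n" using ex xy by metis
    have "x * y = (u * w) * t powi (m + n)"
      using u w t by (simp add: power_int_add)
    then show "val C sh p (x * y) = val C sh p x + val C sh p y"
      using u w val U_mult by metis
  next
    have le: "val C sh p x \<le> val C sh p (x + y)"
      if xy: "x \<noteq> 0" "y \<noteq> 0" "x + y \<noteq> 0" and le: "val C sh p x \<le> val C sh p y" for x y :: 'k
    proof -
      obtain u m where u: "u \<in> U" "x = u * t powi m" using ex xy by metis
      obtain w n where w: "w \<in> U" "y = w * t powi n" using ex xy by metis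
      have "m \<le> n" using le u w val by simp
      \<comment> \<open>The lower power of \<open>t\<close> is factored out; the cofactor lies in
        \<open>A\<close>, so its order is nonnegative.\<close>
      define a where "a = u + w * t powi (n - m)"
      have "a \<in> A"
        unfolding a_def using u w in_A[OF w(1), of "n - m"] \<open>m \<le> n\<close> A(7) by (auto simp: U)
      have xya: "x + y = a * t powi m"
        using u w t(2) by (simp add: a_def algebra_simps power_int_diff)
      then obtain u' k where "u' \<in> U" "a = u' * t ^ k"
        using fac[OF \<open>a \<in> A\<close>] xy by auto
      then have "x + y = u' * t powi (int k + m)" "u' \<in> U"
        using xya t(2) by (simp_all add: power_int_add)
      then have "val C sh p (x + y) = int k + m" using val by simp
      then show ?thesis using u val by simp
    qed
    fix x y :: 'k assume "x \<noteq> 0" "y \<noteq> 0" "x + y \<noteq> 0"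
    then show "min (val C sh p x) (val C sh p y) \<le> val C sh p (x + y)"
      using le[of x y] le[of y x] by (auto simp: min_def add.commute)
  qed
  have A_iff: "x \<in> A \<longleftrightarrow> discrete_val.ge (val C sh p) 0 x" for x
    using ex[of x] val in_A A(2) unfolding discrete_val.ge_def[OF dv] by (cases "x = 0") auto
  then show "stalk C sh p = {x. discrete_val.ge (val C sh p) 0 x}"
    by (auto simp: A_def)
  have "x \<in> max_ideal C sh p \<longleftrightarrow> discrete_val.ge (val C sh p) 1 x" for x
  proof -
    have "x \<in> max_ideal C sh p \<longleftrightarrow> x \<in> A \<and> x \<notin> U"
      by (simp add: max_ideal_def A_def U_def)
    also have "\<dots> \<longleftrightarrow> x = 0 \<or> 1 \<le> val C sh p x"
    proof (cases "x = 0")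
      case True
      then show ?thesis using A(2) U[of x] by simp
    next
      case False
      have "x \<in> A \<longleftrightarrow> 0 \<le> val C sh p x" "inverse x \<in> A \<longleftrightarrow> val C sh p x \<le> 0"
        using A_iff[of x] A_iff[of "inverse x"] False
        by (simp_all add: discrete_val.ge_def[OF dv] discrete_val.v_inverse[OF dv])
      then show ?thesis using U[of x] False by auto
    qed
    finally show ?thesis by (simp only: discrete_val.ge_def[OF dv])
  qed
  then show "max_ideal C sh p = {x. discrete_val.ge (val C sh p) 1 x}"
    by auto
qed

section \<open>Minimality of the resultant\<close>

context discrete_val
begin

lemma ge_mult_0: "ge n x \<Longrightarrow> ge 0 y \<Longrightarrow> ge n (x * y)"
  using ge_0_mult[of y n x] by (simp add: mult.commute)

text \<open>The new coordinates are linear in the old ones, with coefficients that are integer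
  polynomials in the matrix entries; an integral matrix therefore preserves a common lower
  bound.\<close>

lemma ge_conj_model_2:
  assumes "ge 0 \<alpha>" "ge 0 \<beta>" "ge 0 \<gamma>" "ge 0 \<delta>" "length w = 6" "\<forall>x\<in>set w. ge n x"
  shows "\<forall>x\<in>set (conj_model ring_of_type_algebra 2 (\<alpha>, \<beta>, \<gamma>, \<delta>) w). ge n x"
proof -
  obtain a0 a1 a2 b0 b1 b2 where w: "w = [a0, a1, a2, b0, b1, b2]"
    using assms by (auto simp: eval_nat_numeral length_Suc_conv)
  have A: "ge n (x * \<alpha>^2 + y * \<alpha> * \<gamma> + z * \<gamma>^2)"
      "ge n (2 * x * \<alpha> * \<beta> + y * (\<alpha> * \<delta> + \<beta> * \<gamma>) + 2 * z * \<gamma> * \<delta>)"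
      "ge n (x * \<beta>^2 + y * \<beta> * \<delta> + z * \<delta>^2)" if "ge n x" "ge n y" "ge n z" for x y z
    unfolding power2_eq_square mult_2
    by (intro ge_add ge_mult_0 that assms(1-4))+
  have ge: "ge n a0" "ge n a1" "ge n a2" "ge n b0" "ge n b1" "ge n b2"
    using assms(6) by (auto simp: w)
  show ?thesis
    unfolding w conj_model_2 Let_def
    by (simp only: list.set ball_simps, intro conjI ge_diff ge_0_mult A assms(1-4) ge TrueI)
qed

text \<open>
  Modulo the maximal ideal, the hypotheses force \<open>l1 q = - 1\<close> and \<open>l2 = - q\<close>, and then \<open>l1 = 1\<close>.
\<close>
lemma residually_one:
  assumes l: "ge 0 l1" "ge 0 l2" "ge 0 q"
    and 1: "ge 1 (1 + l1 * q)" and 2: "ge 1 (l2 * q + q^2 - q * (1 + l1 * q))"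
    and 3: "ge 1 (l2 + 2 * q - q * l1)"
  shows "ge 1 (l1 - 1)" "ge 1 (l2 - 1)"
proof -
  have "ge 1 ((l2 * q + q^2 - q * (1 + l1 * q)) + q * (1 + l1 * q))"
    by (intro ge_add 2 ge_0_mult l 1)
  also have "(l2 * q + q^2 - q * (1 + l1 * q)) + q * (1 + l1 * q) = q * (l2 + q)"
    by (simp add: algebra_simps power2_eq_square)
  \<comment> \<open>Modulo the maximal ideal \<open>q\<close> has the inverse \<open>- l1\<close>;
    this combination cancels \<open>q\<close> from \<open>q * (l2 + q)\<close>.\<close>
  finally have "ge 1 ((1 + l1 * q) * (l2 + q) - l1 * (q * (l2 + q)))"
    by (intro ge_diff ge_mult_0[OF 1] ge_0_mult[OF l(1)] ge_add l)
  also have "(1 + l1 * q) * (l2 + q) - l1 * (q * (l2 + q)) = l2 + q"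
    by (simp add: algebra_simps)
  finally have 4: "ge 1 (l2 + q)" .
  \<comment> \<open>The inner difference equals \<open>q * (1 - l1)\<close>, and \<open>q\<close> is
    cancelled in the same way.\<close>
  have "ge 1 ((1 + l1 * q) * (1 - l1) - l1 * ((l2 + 2 * q - q * l1) - (l2 + q)))"
    by (intro ge_diff[of 1] ge_mult_0[OF 1] ge_diff[of 0] ge_0_mult[OF l(1)] l 3 4) simp
  also have "(1 + l1 * q) * (1 - l1) - l1 * ((l2 + 2 * q - q * l1) - (l2 + q)) = - (l1 - 1)"
    by (simp add: algebra_simps)
  finally show 5: "ge 1 (l1 - 1)" unfolding ge_uminus .
  have "ge 1 ((l2 + q) - (1 + l1 * q) + q * (l1 - 1))"
    by (intro ge_add ge_diff 1 4 5 ge_0_mult l)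
  also have "(l2 + q) - (1 + l1 * q) + q * (l1 - 1) = l2 - 1"
    by (simp add: algebra_simps)
  finally show "ge 1 (l2 - 1)" .
qed

text \<open>Here the entry \<open>g\<close> of least valuation lies in the first column. After a
  column operation the coordinates \<open>a0\<close>, \<open>b0\<close>, \<open>b1\<close> of the
  conjugate are \<open>c * g^2 * k\<close> or \<open>c * g^3\<close> times integral expressions in
  \<open>q\<close>, up to sign. By \<open>less\<close> these expressions have positive order, which
  is what \<open>residually_one\<close> asks for.\<close>

lemma conj_normal_form_bound_aux:
  assumes l: "ge 0 l1" "ge 0 l2" and c: "c \<noteq> 0" and D: "\<alpha> * \<delta> - \<beta> * \<gamma> \<noteq> 0"
    and n: "\<forall>x\<in>set (conj_model ring_of_type_algebra 2 (\<alpha>, \<beta>, \<gamma>, \<delta>) [c, c * l1, 0, 0, c * l2, c]). ge n x"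
    and g: "g \<in> {\<alpha>, \<gamma>}" "g \<noteq> 0" and min: "ge (v g) \<alpha>" "ge (v g) \<beta>" "ge (v g) \<gamma>" "ge (v g) \<delta>"
    and less: "3 * v (\<alpha> * \<delta> - \<beta> * \<gamma>) + 2 * v c < 2 * n"
  shows "ge 1 (l1 - 1) \<and> ge 1 (l2 - 1)"
proof -
  define k where "k = (\<alpha> * \<delta> - \<beta> * \<gamma>) / g"
  have k: "k \<noteq> 0" "v (\<alpha> * \<delta> - \<beta> * \<gamma>) = v g + v k" "\<alpha> * \<delta> - \<beta> * \<gamma> = g * k"
    using D g by (simp_all add: k_def v_divide)
  \<comment> \<open>All entries have at least the order of \<open>g\<close>, so the determinant
    \<open>g * k\<close> has at least twice that order.\<close>
  have "ge (v g + v g) (\<alpha> * \<delta> - \<beta> * \<gamma>)"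
    by (intro ge_diff ge_mult min)
  then have gk: "v g \<le> v k"
    using D k by (auto simp: ge_def)
  have quot: "ge 0 (x / g)" if "ge (v g) x" for x
    using that g by (auto simp: ge_def v_divide)
  \<comment> \<open>As \<open>v g \<le> v k\<close>, both \<open>3 * v g\<close> and
    \<open>2 * v g + v k\<close> are at most \<open>3/2\<close> times the order of the determinant,
    hence smaller than \<open>n - v c\<close>.\<close>
  have ge1: "ge 1 x" if "ge n (c * g^3 * x) \<or> ge n (c * g^2 * k * x)" for x
  proof -
    have "ge (n - (v c + 3 * v g)) x \<or> ge (n - (v c + 2 * v g + v k)) x"
      using that g c k by (simp add: ge_mult_left_iff v_mult v_power)
    then show ?thesis
      using ge_mono[of _ x 1] less gk k(2) by (smt (verit))
  qed
  \<comment> \<open>A column operation clears the entry next to the minimal one; \<open>q\<close> is the remaining entry of the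
    unimodular factor \<open>U\<close>.\<close>
  from g(1) consider "g = \<alpha>" | "g = \<gamma>" by blast
  then show ?thesis
  proof cases
    case 1
    define q where "q = \<gamma> / \<alpha>"
    have q: "\<gamma> = \<alpha> * q" "ge 0 q"
      using 1 g quot[OF min(3)] by (simp_all add: q_def)
    have "\<forall>x\<in>set (conj_model ring_of_type_algebra 2 (1, - (\<beta> / \<alpha>), 0, 1)
        (conj_model ring_of_type_algebra 2 (\<alpha>, \<beta>, \<gamma>, \<delta>) [c, c * l1, 0, 0, c * l2, c])). ge n x"
      by (rule ge_conj_model_2[OF _ _ _ _ _ n]) (use quot[OF min(2)] 1 in \<open>simp_all add: conj_model_2 Let_def\<close>)
    then have "\<forall>x\<in>set (conj_model ring_of_type_algebra 2
        (\<alpha>, 0, \<alpha> * q, k) [c, c * l1, 0, 0, c * l2, c]). ge n x"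
      using 1 g by (simp add: conj_model_2_comp k_def q_def diff_divide_distrib mult.commute)
    then have "ge n (c * \<alpha>^2 * k * (1 + l1 * q))"
       "ge n (c * \<alpha>^3 * (l2 * q + q^2 - q * (1 + l1 * q)))"
       "ge n (c * \<alpha>^2 * k * (l2 + 2 * q - q * l1))"
      by (simp_all add: conj_model_2 Let_def power2_eq_square power3_eq_cube algebra_simps)
    then have "ge 1 (1 + l1 * q)" "ge 1 (l2 * q + q^2 - q * (1 + l1 * q))" "ge 1 (l2 + 2 * q - q * l1)"
      using ge1 1 by metis+
    then show ?thesis using residually_one l q by blast
  next
    case 2
    define q where "q = \<alpha> / \<gamma>"
    have q: "\<alpha> = \<gamma> * q" "ge 0 q"
      using 2 g quot[OF min(1)] by (simp_all add: q_def)
    have "\<forall>x\<in>set (conj_model ring_of_type_algebra 2 (1, - (\<delta> / \<gamma>), 0, 1)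
        (conj_model ring_of_type_algebra 2 (\<alpha>, \<beta>, \<gamma>, \<delta>) [c, c * l1, 0, 0, c * l2, c])). ge n x"
      by (rule ge_conj_model_2[OF _ _ _ _ _ n]) (use quot[OF min(4)] 2 in \<open>simp_all add: conj_model_2 Let_def\<close>)
    moreover have "\<beta> - \<alpha> * (\<delta> / \<gamma>) = - k"
      using 2 g by (simp add: k_def diff_divide_distrib)
    ultimately have "\<forall>x\<in>set (conj_model ring_of_type_algebra 2
        (\<gamma> * q, - k, \<gamma>, 0) [c, c * l1, 0, 0, c * l2, c]). ge n x"
      using 2 g by (simp add: conj_model_2_comp q_def)
    \<comment> \<open>The unimodular factor is now \<open>(q, -1, 1, 0)\<close>. The conditions are
      those of the first case with \<open>l1\<close> and \<open>l2\<close> exchanged, one of them up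
      to sign.\<close>
    then have "ge n (c * \<gamma>^2 * k * (1 + l2 * q))"
       "ge n (- (c * \<gamma>^3 * (l1 * q + q^2 - q * (1 + l2 * q))))"
       "ge n (c * \<gamma>^2 * k * (l1 + 2 * q - q * l2))"
      by (simp_all add: conj_model_2 Let_def power2_eq_square power3_eq_cube algebra_simps del: ge_uminus)
    then have "ge 1 (1 + l2 * q)" "ge 1 (l1 * q + q^2 - q * (1 + l2 * q))" "ge 1 (l1 + 2 * q - q * l2)"
      using ge1 2 unfolding ge_uminus by metis+
    then show ?thesis using residually_one l q by blast
  qed
qed

text \<open>If the least valuation occurs in the second column, an integral matrix of determinant 1
  exchanges the columns up to sign. The bound expresses minimality: scaling by \<open>c\<close> and
  conjugating add \<open>6 v(det) + 4 v(c)\<close> to the order of the resultant, from which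
  \<open>4 n\<close> is subtracted for \<open>n\<close> the minimal valuation.\<close>

lemma conj_normal_form_bound:
  assumes l: "ge 0 l1" "ge 0 l2" and c: "c \<noteq> 0" and D: "\<alpha> * \<delta> - \<beta> * \<gamma> \<noteq> 0"
    and n: "\<forall>x\<in>set (conj_model ring_of_type_algebra 2 (\<alpha>, \<beta>, \<gamma>, \<delta>) [c, c * l1, 0, 0, c * l2, c]). ge n x"
    and not_one: "\<not> (ge 1 (l1 - 1) \<and> ge 1 (l2 - 1))"
  shows "2 * n \<le> 3 * v (\<alpha> * \<delta> - \<beta> * \<gamma>) + 2 * v c"
proof (rule ccontr)
  assume "\<not> ?thesis"
  then have less: "3 * v (\<alpha> * \<delta> - \<beta> * \<gamma>) + 2 * v c < 2 * n" by simp
  define S where "S = {\<alpha>, \<beta>, \<gamma>, \<delta>} - {0}"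
  have "S \<noteq> {}" "finite S" using D by (auto simp: S_def)
  then obtain g where "g \<in> S" "\<And>x. x \<in> S \<Longrightarrow> v g \<le> v x"
    using ex_min_if_finite[of "v ` S"] by (metis (no_types, lifting) finite_imageI image_iff image_is_empty linorder_not_less)
  then have g: "g \<in> {\<alpha>, \<beta>, \<gamma>, \<delta>}" "g \<noteq> 0"
    and min: "ge (v g) \<alpha>" "ge (v g) \<beta>" "ge (v g) \<gamma>" "ge (v g) \<delta>"
    by (auto simp: S_def ge_def)
  show False
  proof (cases "g \<in> {\<alpha>, \<gamma>}")
    case True
    then show False using conj_normal_form_bound_aux[OF l c D n True g(2) min less] not_one by simp
  next
    case False
    then have g': "g \<in> {\<beta>, \<delta>}" using g by blast
    have "\<forall>x\<in>set (conj_model ring_of_type_algebra 2 (0, -1, 1, 0)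
        (conj_model ring_of_type_algebra 2 (\<alpha>, \<beta>, \<gamma>, \<delta>) [c, c * l1, 0, 0, c * l2, c])). ge n x"
      by (rule ge_conj_model_2[OF _ _ _ _ _ n]) (simp_all add: conj_model_2 Let_def)
    then have "\<forall>x\<in>set (conj_model ring_of_type_algebra 2 (\<beta>, -\<alpha>, \<delta>, -\<gamma>) [c, c * l1, 0, 0, c * l2, c]). ge n x"
      by (simp add: conj_model_2_comp)
    moreover have "\<beta> * (- \<gamma>) - (- \<alpha>) * \<delta> = \<alpha> * \<delta> - \<beta> * \<gamma>"
      by simp
    ultimately show False
      using conj_normal_form_bound_aux[OF l c, of \<beta> "-\<gamma>" "-\<alpha>" \<delta> n g] D g' g(2) min less not_one by simp
  qed
qed

end

section \<open>Unstable reductions\<close>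

lemma conj_model_subring_of:
  fixes A :: "'k::field set"
  assumes sub: "subring A ring_of_type_algebra"
    and "{\<alpha>, \<beta>, \<gamma>, \<delta>} \<subseteq> A" "set v \<subseteq> A" "length v = 2 * d + 2"
  shows "conj_model (subring_of A) d (\<alpha>, \<beta>, \<gamma>, \<delta>) v = conj_model ring_of_type_algebra d (\<alpha>, \<beta>, \<gamma>, \<delta>) v"
proof -
  interpret R: domain "subring_of A" by (rule domain_subring_of[OF sub])
  interpret K: field "ring_of_type_algebra :: 'k ring" by (rule field_from_type_algebra)
  interpret ring_hom_cring "subring_of A" "ring_of_type_algebra :: 'k ring" id
    by unfold_locales (auto simp: Ring.ring_hom_def)
  show ?thesis
    using hom_conj_model[of \<alpha> \<beta> \<gamma> \<delta> v d] assms by simp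
qed

text \<open>In degree 2 the instability conditions concern exactly \<open>a0\<close>,
  \<open>b0\<close>, \<open>b1\<close>, at the positions \<open>0\<close>, \<open>3\<close>,
  \<open>4\<close>. A destabilizing matrix over the local ring is carried by \<open>h\<close> to the
  algebraic closure of the residue field, where its determinant is still 1.\<close>

lemma not_semistable_reductionI:
  fixes C :: "'x topology" and sh :: "'x set \<Rightarrow> 'k::field set"
  assumes sub: "subring (stalk C sh p) ring_of_type_algebra"
    and dvr: "discrete_valuation_ring (local_ring C sh p)"
    and v: "v \<in> \<Phi>" "set v \<subseteq> stalk C sh p" "length v = 6" "min_val C sh p v = 0"
    and \<Gamma>: "{\<alpha>, \<beta>, \<gamma>, \<delta>} \<subseteq> stalk C sh p" "\<alpha> * \<delta> - \<beta> * \<gamma> = 1"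
    and w: "w = conj_model ring_of_type_algebra 2 (\<alpha>, \<beta>, \<gamma>, \<delta>) v"
      "w ! 0 \<in> max_ideal C sh p" "w ! 3 \<in> max_ideal C sh p" "w ! 4 \<in> max_ideal C sh p"
  shows "\<not> semistable_reduction C sh 2 \<Phi> p"
proof -
  let ?R = "local_ring C sh p" and ?M = "max_ideal C sh p" and ?F = "residue_field C sh p"
  define L where "L = field.alg_closure ?F"
  interpret R: domain ?R by (rule domain_subring_of[OF sub])
  interpret M: maximalideal ?M ?R by (rule maximalideal_max_ideal[OF sub dvr])
  interpret F: field ?F
    unfolding residue_field_def by (rule M.quotient_is_field) (rule R.is_cring)
  interpret L: field L
    using F.alg_closureE(1) unfolding L_def algebraic_closure_def by blast
  define \<iota> :: "'k set \<Rightarrow> ('k set list \<times> nat) multiset \<Rightarrow> 'k set"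
    where "\<iota> = F.indexed_const"
  define h where "h = \<iota> \<circ> residue C sh p"
  have "residue C sh p \<in> Ring.ring_hom ?R ?F"
    using M.rcos_ring_hom unfolding residue_def[abs_def] residue_field_def by simp
  then have h: "h \<in> Ring.ring_hom ?R L"
    unfolding h_def L_def \<iota>_def using F.alg_closureE(2) by (rule Ring.ring_hom_trans)
  interpret h: ring_hom_cring ?R L h
    by unfold_locales (rule h)
  have h_0: "h x = \<zero>\<^bsub>L\<^esub>" if "x \<in> ?M" for x
  proof -
    have "residue C sh p x = \<zero>\<^bsub>?F\<^esub>"
      unfolding residue_def residue_field_def FactRing_def using M.a_rcos_const[OF that] by simp
    also have "\<dots> = residue C sh p 0"
      unfolding residue_def residue_field_def FactRing_def
      using M.a_rcos_const[of 0] M.zero_closed by simp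
    finally have "h x = h \<zero>\<^bsub>?R\<^esub>" by (simp add: h_def)
    then show ?thesis using h.hom_zero by simp
  qed
  have len: "length w = 6" by (simp add: w conj_model_def Let_def)
  have "map h w = map h (conj_model ?R 2 (\<alpha>, \<beta>, \<gamma>, \<delta>) v)"
    unfolding w using conj_model_subring_of[OF sub \<Gamma>(1) v(2)] v(3) by simp
  also have "\<dots> = conj_model L 2 (h \<alpha>, h \<beta>, h \<gamma>, h \<delta>) (map h v)"
    using h.hom_conj_model[of \<alpha> \<beta> \<gamma> \<delta> v 2] \<Gamma>(1) v by simp
  finally have conj: "conj_model L 2 (h \<alpha>, h \<beta>, h \<gamma>, h \<delta>) (map \<iota> (map (residue C sh p) v)) = map h w"
    by (simp add: h_def)
  have mults: "\<alpha> * \<delta> \<in> stalk C sh p" "\<beta> * \<gamma> \<in> stalk C sh p"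
    using \<Gamma>(1) subringE(6)[OF sub] by auto
  have "h (\<alpha> * \<delta>) = h (\<one>\<^bsub>?R\<^esub> \<oplus>\<^bsub>?R\<^esub> \<beta> * \<gamma>)"
    using \<Gamma>(2) by (simp add: algebra_simps)
  also have "\<dots> = \<one>\<^bsub>L\<^esub> \<oplus>\<^bsub>L\<^esub> h (\<beta> * \<gamma>)"
    using h.hom_add[OF R.one_closed, of "\<beta> * \<gamma>"] h.hom_one mults by simp
  finally have det: "h (\<alpha> * \<delta>) = \<one>\<^bsub>L\<^esub> \<oplus>\<^bsub>L\<^esub> h (\<beta> * \<gamma>)" .
  have hs: "h \<alpha> \<in> carrier L" "h \<beta> \<in> carrier L" "h \<gamma> \<in> carrier L" "h \<delta> \<in> carrier L" "h (\<beta> * \<gamma>) \<in> carrier L"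
    using \<Gamma>(1) mults h.hom_closed by auto
  have "h \<alpha> \<otimes>\<^bsub>L\<^esub> h \<delta> = h (\<alpha> * \<delta>)" "h \<beta> \<otimes>\<^bsub>L\<^esub> h \<gamma> = h (\<beta> * \<gamma>)"
    using h.hom_mult[of \<alpha> \<delta>] h.hom_mult[of \<beta> \<gamma>] \<Gamma>(1) by simp_all
  then have "h \<alpha> \<otimes>\<^bsub>L\<^esub> h \<delta> \<ominus>\<^bsub>L\<^esub> h \<beta> \<otimes>\<^bsub>L\<^esub> h \<gamma> = \<one>\<^bsub>L\<^esub>"
    using hs by (simp add: det a_minus_def L.a_assoc L.r_neg)
  then have SL2: "(h \<alpha>, h \<beta>, h \<gamma>, h \<delta>) \<in> SL2 L"
    using hs by (simp add: SL2_def)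
  have "Fa 2 (map h w) ! 0 = \<zero>\<^bsub>L\<^esub>" "Fb 2 (map h w) ! 0 = \<zero>\<^bsub>L\<^esub>" "Fb 2 (map h w) ! 1 = \<zero>\<^bsub>L\<^esub>"
    using w(2-4) len by (simp_all add: Fa_def Fb_def h_0)
  then have zeros: "\<forall>i\<le>2. (2 * i + 1 \<le> 2 \<longrightarrow> Fa 2 (map h w) ! i = \<zero>\<^bsub>L\<^esub>) \<and>
                 (2 * i \<le> 2 + 1 \<longrightarrow> Fb 2 (map h w) ! i = \<zero>\<^bsub>L\<^esub>)"
    by (auto simp: le_Suc_eq numeral_2_eq_2)
  have "map (residue C sh p) v \<in> reduction C sh p \<Phi>"
    using v by (auto simp: reduction_def)
  then have "unstable ?F 2 (reduction C sh p \<Phi>)"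
    unfolding unstable_def Let_def L_def[symmetric] \<iota>_def[symmetric]
    using SL2 zeros conj by (intro bexI[of _ "map (residue C sh p) v"] bexI[of _ "(h \<alpha>, h \<beta>, h \<gamma>, h \<delta>)"]) auto
  then show ?thesis
    by (simp add: semistable_reduction_def semistable_def)
qed

section \<open>Presentations of the normal form\<close>

lemma proj_point_type_algebra:
  fixes v :: "'k::field list"
  shows "proj_point ring_of_type_algebra v = {map ((*) c) v | c. c \<noteq> 0}"
proof -
  have "(\<otimes>\<^bsub>ring_of_type_algebra\<^esub>) = ((*) :: 'k \<Rightarrow> _)"
    by (simp add: fun_eq_iff)
  then show ?thesis by (simp add: proj_point_def)
qed

lemma P1_point_eqD:
  assumes "P1_point x y = P1_point x' y'"
  shows "x * y' = x' * y"
proof -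
  have "[x, y] \<in> P1_point x y"
    unfolding proj_point_type_algebra by (auto intro!: exI[of _ 1])
  then obtain c where "[x, y] = map ((*) c) [x', y']"
    unfolding assms unfolding proj_point_type_algebra by auto
  then show ?thesis by simp
qed

lemma form_eval_2: "form_eval 2 [c0, c1, c2] x y = to_ac c0 * x^2 + to_ac c1 * x * y + to_ac c2 * y^2"
  by (simp add: form_eval_def numeral_2_eq_2)

text \<open>A polynomial of degree at most 2 vanishing at \<open>1\<close>, \<open>-1\<close> and
  \<open>2\<close> is zero, because these points are distinct in characteristic 0.\<close>

lemma quadratic_eq_0:
  fixes a b c :: "'k::field_char_0"
  assumes "c + b + a = 0" "c - b + a = 0" "c + 2 * b + 4 * a = 0"
  shows "a = 0" "b = 0" "c = 0"
proof -
  have "2 * b = (c + b + a) - (c - b + a)" by simp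
  then show b: "b = 0" using assms by simp
  have "3 * a = (c + 2 * b + 4 * a) - (c + b + a)" by (simp add: b)
  then show "a = 0" using assms by simp
  then show "c = 0" using assms b by simp
qed

text \<open>Both presentations have the same values, so cross-multiplication equates values of two
  quartic forms, and a few rational points determine the coefficients. The minimum over all
  presentations thus only involves multiples of the normal form.\<close>

lemma presentation_normal_form_unique:
  fixes \<phi> :: "'k::field_char_0 P1_map"
  assumes pres: "presentation 2 \<phi> (proj_point ring_of_type_algebra [1, l1, 0, 0, l2, 1])"
    and pres': "presentation 2 \<phi> \<Phi>'" and v: "v \<in> \<Phi>'"
  obtains c where "c \<noteq> 0" "v = map ((*) c) [1, l1, 0, 0, l2, 1]" "l1 * l2 \<noteq> 1"
proof -
  let ?v0 = "[1, l1, 0, 0, l2, 1]"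
  have v0: "?v0 \<in> proj_point ring_of_type_algebra ?v0"
    unfolding proj_point_type_algebra by (auto intro!: exI[of _ 1])
  have "length v = 6" and v_nz: "\<not> set v \<subseteq> {0}"
  proof -
    obtain u where u: "length u = 6" "\<not> set u \<subseteq> {0}" "\<Phi>' = proj_point ring_of_type_algebra u"
      using pres' unfolding presentation_def proj_space_def by auto
    then obtain c where "c \<noteq> 0" "v = map ((*) c) u"
      using v unfolding proj_point_type_algebra by auto
    then show "length v = 6" "\<not> set v \<subseteq> {0}" using u(1,2) by auto
  qed
  then obtain a0 a1 a2 b0 b1 b2 where v_eq: "v = [a0, a1, a2, b0, b1, b2]"
    by (auto simp: eval_nat_numeral length_Suc_conv)
  have eval0: "form_eval 2 (Fa 2 ?v0) x y = x^2 + to_ac l1 * x * y"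
      "form_eval 2 (Fb 2 ?v0) x y = to_ac l2 * x * y + y^2" for x y :: "'k alg_closure"
    by (simp_all add: Fa_def Fb_def form_eval_2)
  have eval: "form_eval 2 (Fa 2 v) x y = to_ac a0 * x^2 + to_ac a1 * x * y + to_ac a2 * y^2"
      "form_eval 2 (Fb 2 v) x y = to_ac b0 * x^2 + to_ac b1 * x * y + to_ac b2 * y^2" for x y :: "'k alg_closure"
    by (simp_all add: Fa_def Fb_def form_eval_2 v_eq)
  \<comment> \<open>Otherwise \<open>[- l1 : 1]\<close> would be a common zero of the two
    forms.\<close>
  have l12: "l1 * l2 \<noteq> 1"
  proof
    assume l: "l1 * l2 = 1"
    have "(form_eval 2 (Fa 2 ?v0) (- to_ac l1) 1, form_eval 2 (Fb 2 ?v0) (- to_ac l1) 1) \<noteq> (0, 0)"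
      using pres v0 unfolding presentation_def by (metis prod.inject zero_neq_one)
    moreover have "to_ac l1 * to_ac l2 = 1"
      using l by (metis to_ac_mult to_ac_1)
    ultimately show False
      unfolding eval0 by (simp add: power2_eq_square mult.commute)
  qed
  have eq: "(x^2 + l1 * x * y) * (b0 * x^2 + b1 * x * y + b2 * y^2) =
      (a0 * x^2 + a1 * x * y + a2 * y^2) * (l2 * x * y + y^2)" if "(x, y) \<noteq> (0, 0)" for x y :: 'k
  proof -
    have "(to_ac x, to_ac y) \<noteq> (0, 0)" using that by simp
    then have "P1_point (form_eval 2 (Fa 2 ?v0) (to_ac x) (to_ac y)) (form_eval 2 (Fb 2 ?v0) (to_ac x) (to_ac y)) =
        P1_point (form_eval 2 (Fa 2 v) (to_ac x) (to_ac y)) (form_eval 2 (Fb 2 v) (to_ac x) (to_ac y))"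
      using pres pres' v0 v unfolding presentation_def by metis
    from P1_point_eqD[OF this]
    have "to_ac ((x^2 + l1 * x * y) * (b0 * x^2 + b1 * x * y + b2 * y^2)) =
        to_ac ((a0 * x^2 + a1 * x * y + a2 * y^2) * (l2 * x * y + y^2))"
      unfolding eval0 eval by simp
    then show ?thesis by (rule injD[OF inj_to_ac])
  qed
  have b0: "b0 = 0" using eq[of 1 0] by simp
  have a2: "a2 = 0" using eq[of 0 1] by simp
  \<comment> \<open>Once \<open>b0\<close> and \<open>a2\<close> vanish, the difference of the two
    sides is \<open>x * y\<close> times a quadratic form, whose values at \<open>[1 : 1]\<close>,
    \<open>[-1 : 1]\<close> and \<open>[2 : 1]\<close> are taken here.\<close>
  have quad: "l1 * b2 - a1 + (l1 * b1 + b2 - l2 * a1 - a0) + (b1 - l2 * a0) = 0"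
    "l1 * b2 - a1 - (l1 * b1 + b2 - l2 * a1 - a0) + (b1 - l2 * a0) = 0"
    "l1 * b2 - a1 + 2 * (l1 * b1 + b2 - l2 * a1 - a0) + 4 * (b1 - l2 * a0) = 0"
  proof -
    show "l1 * b2 - a1 + (l1 * b1 + b2 - l2 * a1 - a0) + (b1 - l2 * a0) = 0"
      using eq[of 1 1] by (simp add: b0 a2 algebra_simps)
    show "l1 * b2 - a1 - (l1 * b1 + b2 - l2 * a1 - a0) + (b1 - l2 * a0) = 0"
      using eq[of "-1" 1] by (simp add: b0 a2 algebra_simps)
    have "2 * (l1 * b2 - a1 + 2 * (l1 * b1 + b2 - l2 * a1 - a0) + 4 * (b1 - l2 * a0)) = 0"
      using eq[of 2 1] by (simp add: b0 a2 algebra_simps)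
    then show "l1 * b2 - a1 + 2 * (l1 * b1 + b2 - l2 * a1 - a0) + 4 * (b1 - l2 * a0) = 0"
      by (simp only: mult_eq_0_iff) simp
  qed
  from quadratic_eq_0[OF quad] have b1: "b1 = l2 * a0" and a1: "a1 = l1 * b2"
    and mid: "l1 * b1 + b2 - l2 * a1 - a0 = 0" by simp_all
  have "(b2 - a0) * (1 - l1 * l2) = 0"
    using mid unfolding a1 b1 by (simp add: algebra_simps)
  then have b2: "b2 = a0" using l12 by simp
  have "v = map ((*) a0) ?v0" by (simp add: v_eq a1 a2 b0 b1 b2 mult.commute)
  moreover have "a0 \<noteq> 0" using v_nz calculation by auto
  ultimately show thesis using that l12 by blast
qed

section \<open>Local rings of an integral scheme\<close>

lemma topspace_zariski: "Q \<in> topspace (zariski R) \<Longrightarrow> primeideal Q R"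
  by (auto simp: zariski_def topology_generated_by_topspace)

lemma openin_zariski_principal: "f \<in> carrier R \<Longrightarrow> openin (zariski R) {Q. primeideal Q R \<and> f \<notin> Q}"
  unfolding zariski_def by (rule topology_generated_by_Basis) auto

text \<open>By primeness the principal open set of a product is the intersection of those of its
  factors, so the generating sets form a basis.\<close>

lemma zariski_principal_basis:
  assumes "monoid R" "openin (zariski R) T" "Q \<in> T"
  shows "\<exists>f\<in>carrier R. primeideal Q R \<and> f \<notin> Q \<and> {Q. primeideal Q R \<and> f \<notin> Q} \<subseteq> T"
proof -
  have "generate_topology_on {{Q. primeideal Q R \<and> f \<notin> Q} | f. f \<in> carrier R} T"
    using assms(2) unfolding zariski_def by (rule openin_topology_generated_by)
  then show ?thesis using assms(3)
  proof (induction arbitrary: Q rule: generate_topology_on.induct)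
    case (Int A B)
    obtain f g where f: "f \<in> carrier R" "primeideal Q R" "f \<notin> Q" "{Q. primeideal Q R \<and> f \<notin> Q} \<subseteq> A"
      and g: "g \<in> carrier R" "g \<notin> Q" "{Q. primeideal Q R \<and> g \<notin> Q} \<subseteq> B"
      using Int.IH(1)[of Q] Int.IH(2)[of Q] Int.prems by blast
    have fg: "f \<otimes>\<^bsub>R\<^esub> g \<in> carrier R"
      using monoid.m_closed[OF assms(1)] f g by blast
    have "f \<otimes>\<^bsub>R\<^esub> g \<notin> Q"
      using primeideal.I_prime[OF f(2,1) g(1)] f(3) g(2) by blast
    moreover have "f \<notin> P" "g \<notin> P" if "primeideal P R" "f \<otimes>\<^bsub>R\<^esub> g \<notin> P" for P
      using ideal.I_r_closed[OF primeideal.axioms(1)[OF that(1)] _ g(1), of f]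
        ideal.I_l_closed[OF primeideal.axioms(1)[OF that(1)] _ f(1), of g] that(2) by blast+
    ultimately show ?case using f(2,4) g(3) fg by blast
  next
    case (UN K)
    then obtain k where "k \<in> K" "Q \<in> k" by blast
    then show ?case using UN.IH by blast
  qed blast+
qed

context integral_scheme
begin

text \<open>The stalk is a directed union of subrings: two germs are both sections over the
  intersection of their domains.\<close>

lemma subring_stalk:
  assumes "p \<in> topspace C"
  shows "subring (stalk C sh p) ring_of_type_algebra"
proof -
  interpret K: field "ring_of_type_algebra :: 'k ring" by (rule field_from_type_algebra)
  have common: "\<exists>U. openin C U \<and> p \<in> U \<and> x \<in> sh U \<and> y \<in> sh U"
    if "x \<in> stalk C sh p" "y \<in> stalk C sh p" for x y
  proof -
    obtain U V where U: "openin C U" "p \<in> U" "x \<in> sh U" and V: "openin C V" "p \<in> V" "y \<in> sh V"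
      using \<open>x \<in> stalk C sh p\<close> \<open>y \<in> stalk C sh p\<close> unfolding stalk_def by blast
    have "openin C (U \<inter> V)" "p \<in> U \<inter> V" using U V by auto
    moreover have "sh U \<subseteq> sh (U \<inter> V)" "sh V \<subseteq> sh (U \<inter> V)"
      using restriction[of U "U \<inter> V"] restriction[of V "U \<inter> V"] U V calculation by blast+
    ultimately show ?thesis using U(3) V(3) by blast
  qed
  have in_stalk: "x \<in> stalk C sh p" if "openin C U" "p \<in> U" "x \<in> sh U" for x U
    using that unfolding stalk_def by blast
  have sub: "subring (sh U) ring_of_type_algebra" if "openin C U" "p \<in> U" for U
    using sections_subring that by blast
  show ?thesis
  proof (rule K.subringI)
    show "\<one>\<^bsub>(ring_of_type_algebra :: 'k ring)\<^esub> \<in> stalk C sh p"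
      using in_stalk[of "topspace C"] subringE(3)[OF sub[of "topspace C"]] assms by simp
  next
    fix x assume "x \<in> stalk C sh p"
    then show "\<ominus>\<^bsub>ring_of_type_algebra\<^esub> x \<in> stalk C sh p"
      using common[of x x] in_stalk subringE(5)[OF sub] by meson
  next
    fix x y assume "x \<in> stalk C sh p" "y \<in> stalk C sh p"
    then obtain U where U: "openin C U" "p \<in> U" "x \<in> sh U" "y \<in> sh U"
      using common by meson
    then show "x \<otimes>\<^bsub>ring_of_type_algebra\<^esub> y \<in> stalk C sh p" "x \<oplus>\<^bsub>ring_of_type_algebra\<^esub> y \<in> stalk C sh p"
      using in_stalk[OF U(1,2)] subringE(6,7)[OF sub[OF U(1,2)]] by meson+
  qed simp
qed

lemma openin_principal:
  assumes "affine_open C sh U" "f \<in> sh U"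
  shows "openin C {x \<in> U. f \<notin> max_ideal C sh x}"
proof -
  let ?\<phi> = "\<lambda>x. {g \<in> sh U. g \<in> max_ideal C sh x}" and ?R = "subring_of (sh U)"
  have U: "openin C U" "homeomorphic_map (subtopology C U) (zariski ?R) ?\<phi>"
    using assms(1) by (auto simp: affine_open_def)
  then have top: "topspace (subtopology C U) = U"
    using openin_subset by auto
  have cont: "continuous_map (subtopology C U) (zariski ?R) ?\<phi>"
    using U(2) by (rule homeomorphic_imp_continuous_map)
  have "openin (zariski ?R) {Q. primeideal Q ?R \<and> f \<notin> Q}"
    by (rule openin_zariski_principal) (use assms(2) in simp)
  then have "openin (subtopology C U) {x \<in> topspace (subtopology C U). ?\<phi> x \<in> {Q. primeideal Q ?R \<and> f \<notin> Q}}"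
    by (rule openin_continuous_map_preimage[OF cont])
  moreover have "primeideal (?\<phi> x) ?R" if "x \<in> U" for x
    using topspace_zariski continuous_map_funspace[OF cont] that top by blast
  then have "{x \<in> topspace (subtopology C U). ?\<phi> x \<in> {Q. primeideal Q ?R \<and> f \<notin> Q}} = {x \<in> U. f \<notin> max_ideal C sh x}"
    using assms(2) unfolding top by blast
  ultimately show ?thesis
    using openin_trans_full U(1) by auto
qed

text \<open>The element \<open>x\<close> is a section over some open \<open>V\<close>, which may
  miss \<open>p\<close>. For an affine neighbourhood \<open>U\<close> of \<open>p\<close>, a
  principal open set inside \<open>U \<inter> V\<close> exhibits \<open>x\<close> as
  \<open>g / f ^ n\<close> with \<open>g\<close> and \<open>f\<close> sections over
  \<open>U\<close>, hence in the stalk.\<close>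

lemma stalk_fractions:
  assumes p: "p \<in> topspace C"
  shows "\<exists>a\<in>stalk C sh p. \<exists>b\<in>stalk C sh p. b \<noteq> 0 \<and> x = a / b"
proof -
  obtain U where U: "affine_open C sh U" "p \<in> U"
    using locally_affine[OF p] by blast
  let ?\<phi> = "\<lambda>x. {g \<in> sh U. g \<in> max_ideal C sh x}" and ?R = "subring_of (sh U)"
  have open_U: "openin C U" and homeo: "homeomorphic_map (subtopology C U) (zariski ?R) ?\<phi>"
    and principal: "\<And>f. f \<in> sh U \<Longrightarrow> f \<noteq> 0 \<Longrightarrow>
        sh {x \<in> U. f \<notin> max_ideal C sh x} = {g / f ^ n | g n. g \<in> sh U}"
    using U(1) by (auto simp: affine_open_def)
  have top: "topspace (subtopology C U) = U"
    using open_U openin_subset by auto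
  obtain V where V: "openin C V" "V \<noteq> {}" "x \<in> sh V"
    using function_field by blast
  define W where "W = U \<inter> V"
  have "W \<noteq> {}" using irreducible[OF open_U _ V(1,2)] U(2) by (auto simp: W_def)
  then obtain y where y: "y \<in> W" by blast
  have "openin (subtopology C U) W"
    using V(1) by (auto simp: W_def openin_subtopology)
  then have "openin (zariski ?R) (?\<phi> ` W)"
    using homeomorphic_imp_open_map[OF homeo] by (simp add: open_map_def)
  moreover have subU: "subring (sh U) ring_of_type_algebra"
    using sections_subring open_U U(2) by blast
  then interpret R: domain ?R by (rule domain_subring_of)
  have "monoid ?R" by (rule R.monoid_axioms)
  ultimately obtain f where f: "f \<in> sh U" "f \<notin> ?\<phi> y" "{Q. primeideal Q ?R \<and> f \<notin> Q} \<subseteq> ?\<phi> ` W"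
    using zariski_principal_basis[of ?R "?\<phi> ` W" "?\<phi> y"] y by auto
  let ?D = "{x \<in> U. f \<notin> max_ideal C sh x}"
  have "y \<in> ?D" using y f by (auto simp: W_def)
  \<comment> \<open>Since \<open>f\<close> avoids the maximal ideal at \<open>y\<close>, it is
    nonzero and may serve as a denominator.\<close>
  have "0 \<in> max_ideal C sh y"
    using subringE(2)[OF subring_stalk[of y]] y open_U openin_subset
    unfolding max_ideal_def Units_subring_of W_def by auto
  then have "f \<noteq> 0" using \<open>y \<in> ?D\<close> by blast
  have inj: "inj_on ?\<phi> U"
    using homeomorphic_imp_injective_map[OF homeo] top by simp
  have prime: "primeideal (?\<phi> z) ?R" if "z \<in> U" for z
    using topspace_zariski homeomorphic_imp_surjective_map[OF homeo] that top by blast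
  have "?D \<subseteq> W"
  proof
    fix z assume z: "z \<in> ?D"
    then have "?\<phi> z \<in> ?\<phi> ` W" using f prime by auto
    then obtain z' where "z' \<in> W" "?\<phi> z = ?\<phi> z'" by blast
    then show "z \<in> W" using inj_onD[OF inj, of z z'] z by (auto simp: W_def)
  qed
  then have "x \<in> sh ?D"
    using restriction[OF V(1) openin_principal[OF U(1) f(1)]] V(3) \<open>y \<in> ?D\<close> unfolding W_def by blast
  then obtain g n where gn: "g \<in> sh U" "x = g / f ^ n"
    using principal[OF f(1) \<open>f \<noteq> 0\<close>] by blast
  have "f ^ n \<in> sh U"
    using f(1) subringE(3,6)[OF subU] by (induction n) auto
  moreover have "sh U \<subseteq> stalk C sh p"
    using open_U U(2) unfolding stalk_def by blast
  ultimately show ?thesis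
    using gn \<open>f \<noteq> 0\<close> by (intro bexI[of _ g] bexI[of _ "f ^ n"]) auto
qed

section \<open>Closures of points and dimension one\<close>

lemma separate_points:
  assumes "x \<in> topspace C" "y \<in> topspace C" "x \<noteq> y"
  shows "\<exists>V. openin C V \<and> (x \<in> V) \<noteq> (y \<in> V)"
proof -
  obtain U where U: "affine_open C sh U" "x \<in> U"
    using locally_affine assms(1) by blast
  have open_U: "openin C U"
    and homeo: "homeomorphic_map (subtopology C U) (zariski (subring_of (sh U))) (\<lambda>x. {g \<in> sh U. g \<in> max_ideal C sh x})"
    using U(1) by (auto simp: affine_open_def)
  have "topspace (subtopology C U) = U"
    using open_U openin_subset by auto
  then have inj: "inj_on (\<lambda>x. {g \<in> sh U. g \<in> max_ideal C sh x}) U"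
    using homeomorphic_imp_injective_map[OF homeo] by simp
  show ?thesis
  \<comment> \<open>In a common affine open set, a section lying in only one of the two primes gives
    a separating principal open set; otherwise \<open>U\<close> itself separates.\<close>
  proof (cases "y \<in> U")
    case True
    then obtain f where "f \<in> sh U" "(f \<in> max_ideal C sh x) \<noteq> (f \<in> max_ideal C sh y)"
      using inj_onD[OF inj, of x y] U(2) assms(3) by blast
    then show ?thesis
      using openin_principal[OF U(1)] U(2) True by (intro exI[of _ "{z \<in> U. f \<notin> max_ideal C sh z}"]) auto
  next
    case False
    then show ?thesis using U open_U by blast
  qed
qed

lemma irreducible_closed_closure:
  assumes "x \<in> topspace C"
  shows "irreducible_closed C (C closure_of {x})"
proof -
  have x: "x \<in> C closure_of {x}"
    using assms closure_of_subset[of "{x}" C] by blast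
  have "C closure_of {x} \<subseteq> A" if "closedin C A" "x \<in> A" for A
    using that by (intro closure_of_minimal) auto
  then show ?thesis
    using x unfolding irreducible_closed_def by auto
qed

lemma irreducible_closed_topspace: "irreducible_closed C (topspace C)"
proof -
  have "topspace C \<subseteq> A \<or> topspace C \<subseteq> B"
    if "closedin C A" "closedin C B" "topspace C \<subseteq> A \<union> B" for A B
    using irreducible[of "topspace C - A" "topspace C - B"] that by (auto simp: closedin_def)
  then show ?thesis using nonempty by (auto simp: irreducible_closed_def)
qed

text \<open>A non-closed point outside \<open>V\<close> would start a forbidden chain of three
  irreducible closed sets: the closure of another point \<open>y\<close> of its closure, its own
  closure, and the whole space.\<close>

lemma not_closed_imp_generic:
  assumes dim: "one_dimensional C" and x: "x \<in> topspace C" "x \<notin> closed_points C"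
    and V: "openin C V" "V \<noteq> {}"
  shows "x \<in> V"
proof (rule ccontr)
  assume "x \<notin> V"
  let ?Z = "C closure_of {x}"
  have x_in: "x \<in> ?Z"
    using x(1) closure_of_subset[of "{x}" C] by blast
  have "closedin C (topspace C - V)" using V by auto
  then have "?Z \<subseteq> topspace C - V"
    using x(1) \<open>x \<notin> V\<close> by (intro closure_of_minimal) auto
  moreover have "V \<subseteq> topspace C" using V openin_subset by auto
  ultimately have Z_top: "?Z \<subset> topspace C" using V(2) by blast
  have "?Z \<noteq> {x}"
    using x(2) closedin_closure_of[of C "{x}"] unfolding closed_points_def by (metis mem_Collect_eq)
  then obtain y where y: "y \<in> ?Z" "y \<noteq> x" using x_in by blast
  have y_top: "y \<in> topspace C" using y(1) Z_top by blast
  obtain W where W: "openin C W" "(x \<in> W) \<noteq> (y \<in> W)"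
    using separate_points[OF x(1) y_top] y(2) by metis
  have "y \<in> W \<Longrightarrow> x \<in> W"
    using y(1) W(1) unfolding in_closure_of by blast
  then have xy: "x \<in> W" "y \<notin> W" using W(2) by auto
  have "C closure_of {y} \<subseteq> topspace C - W"
    using y_top xy W(1) by (intro closure_of_minimal) auto
  moreover have "C closure_of {y} \<subseteq> ?Z"
    using y(1) by (intro closure_of_minimal) auto
  ultimately have "C closure_of {y} \<subset> ?Z" using x_in xy by blast
  then show False
    using dim irreducible_closed_closure[OF x(1)] irreducible_closed_closure[OF y_top]
      irreducible_closed_topspace Z_top unfolding one_dimensional_def by blast
qed

text \<open>The regular locus is the union of all nonempty open sets over which \<open>f\<close> is
  a section, and \<open>f\<close> glues there. It contains the non-closed points, as these lie in
  every nonempty open set.\<close>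

lemma
  fixes f :: 'k
  assumes dim: "one_dimensional C"
  defines "S \<equiv> {p \<in> closed_points C. f \<notin> stalk C sh p}"
  shows openin_regular_locus: "openin C (topspace C - S)"
    and regular_locus_nonempty: "topspace C - S \<noteq> {}"
    and section_regular_locus: "f \<in> sh (topspace C - S)"
proof -
  define \<V> where "\<V> = {V. openin C V \<and> V \<noteq> {} \<and> f \<in> sh V}"
  obtain V where V: "V \<in> \<V>"
    using function_field unfolding \<V>_def by blast
  have "\<Union>\<V> = topspace C - S"
  proof (intro equalityI subsetI)
    fix y assume "y \<in> \<Union>\<V>"
    then show "y \<in> topspace C - S"
      using openin_subset unfolding \<V>_def S_def stalk_def by blast
  next
    fix y assume y: "y \<in> topspace C - S"
    show "y \<in> \<Union>\<V>"
    proof (cases "y \<in> closed_points C")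
      case True
      then show ?thesis
        using y unfolding S_def stalk_def \<V>_def by blast
    next
      case False
      then have "y \<in> V" using not_closed_imp_generic[OF dim] y V by (auto simp: \<V>_def)
      then show ?thesis using V by blast
    qed
  qed
  moreover have "openin C (\<Union>\<V>)" by (rule openin_Union) (auto simp: \<V>_def)
  moreover have "f \<in> sh (\<Union>\<V>)"
    using gluing[of \<V>] V unfolding \<V>_def by blast
  moreover have "\<Union>\<V> \<noteq> {}" using V by (auto simp: \<V>_def)
  ultimately show "openin C (topspace C - S)" "topspace C - S \<noteq> {}" "f \<in> sh (topspace C - S)"
    by simp_all
qed

end

section \<open>The normal form at a closed point\<close>

lemma (in discrete_val) Min_val_eq_0:
  assumes "\<forall>x\<in>set w. ge 0 x" "1 \<in> set w"
  shows "Min (v ` (set w - {0})) = 0"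
proof (rule Min_eqI)
  show "0 \<in> v ` (set w - {0})" using assms(2) by (auto intro!: image_eqI[of _ _ 1])
qed (use assms(1) in \<open>auto simp: ge_def\<close>)

lemma (in discrete_val) ge_Min_val:
  assumes "x \<in> set w"
  shows "ge (Min (v ` (set w - {0}))) x"
  using assms by (auto simp: ge_def)

lemma conj_model_2_one:
  fixes w :: "'a::comm_ring_1 list"
  assumes "length w = 6"
  shows "conj_model ring_of_type_algebra 2 (1, 0, 0, 1) w = w"
proof -
  obtain a0 a1 a2 b0 b1 b2 where w: "w = [a0, a1, a2, b0, b1, b2]"
    using assms by (auto simp: eval_nat_numeral length_Suc_conv)
  show ?thesis by (simp add: w conj_model_2)
qed

text \<open>Each excluded configuration is refuted by a factor \<open>e\<close> making the model
  integral with a coordinate \<open>1\<close>, and a matrix after which \<open>a0\<close>,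
  \<open>b0\<close>, \<open>b1\<close> vanish in the residue field.\<close>

lemma (in integral_scheme) semistable_normal_form:
  assumes p: "p \<in> topspace C" and dvr: "discrete_valuation_ring (local_ring C sh p)"
    and ss: "semistable_reduction C sh 2 (proj_point ring_of_type_algebra [1, l1, 0, 0, l2, 1]) p"
  shows "l1 \<in> stalk C sh p \<longleftrightarrow> l2 \<in> stalk C sh p"
    and "\<not> (l1 - 1 \<in> max_ideal C sh p \<and> l2 - 1 \<in> max_ideal C sh p)"
proof -
  note sub = subring_stalk[OF p]
  note dv = discrete_val_val[OF sub dvr stalk_fractions[OF p]]
  interpret discrete_val "val C sh p" by (rule dv(1))
  have model: False
    if "e \<noteq> 0" "\<forall>x\<in>{e, e * l1, e * l2}. ge 0 x" "1 \<in> {e, e * l1, e * l2}"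
      "ge 0 \<alpha>" "ge 0 \<beta>" "ge 0 \<gamma>" "ge 0 \<delta>" "\<alpha> * \<delta> - \<beta> * \<gamma> = 1"
      and w: "w = conj_model ring_of_type_algebra 2 (\<alpha>, \<beta>, \<gamma>, \<delta>) [e, e * l1, 0, 0, e * l2, e]"
      "ge 1 (w ! 0)" "ge 1 (w ! 3)" "ge 1 (w ! 4)" for e \<alpha> \<beta> \<gamma> \<delta> w
  proof -
    have "[e, e * l1, 0, 0, e * l2, e] \<in> proj_point ring_of_type_algebra [1, l1, 0, 0, l2, 1]"
      unfolding proj_point_type_algebra using that(1) by (auto intro!: exI[of _ e])
    moreover have "set [e, e * l1, 0, 0, e * l2, e] \<subseteq> stalk C sh p"
      using that(2) by (simp add: dv(2))
    moreover have "min_val C sh p [e, e * l1, 0, 0, e * l2, e] = 0"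
      unfolding min_val_def by (rule Min_val_eq_0) (use that(2,3) in auto)
    ultimately have "\<not> semistable_reduction C sh 2 (proj_point ring_of_type_algebra [1, l1, 0, 0, l2, 1]) p"
      using that by (intro not_semistable_reductionI[OF sub dvr, of _ _ \<alpha> \<beta> \<gamma> \<delta> w]) (simp_all add: dv(2,3))
    then show False using ss by simp
  qed
  have inv: "l \<noteq> 0 \<and> ge 1 (inverse l)" if "\<not> ge 0 l" for l
    using that by (auto simp: ge_def v_inverse)
  \<comment> \<open>Scaled by \<open>inverse l1\<close>, the model reduces to
    \<open>[XY : 0]\<close>, for which the identity matrix suffices.\<close>
  have 1: "ge 0 l1" if "ge 0 l2"
  proof (rule ccontr)
    assume "\<not> ge 0 l1"
    then have l1: "l1 \<noteq> 0" "ge 1 (inverse l1)" using inv by auto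
    moreover have "ge 1 (inverse l1 * l2)" by (intro ge_mult_0 that l1)
    moreover note ge_mono[OF calculation(2), of 0] ge_mono[OF calculation(3), of 0]
    ultimately show False
      by (intro model[of "inverse l1" 1 0 0 1, OF _ _ _ _ _ _ _ _ refl]) (auto simp: conj_model_2_one)
  qed
  \<comment> \<open>The reduction is now \<open>[0 : XY]\<close>; the matrix exchanges the two
    coordinates up to sign.\<close>
  have 2: "ge 0 l2" if "ge 0 l1"
  proof (rule ccontr)
    assume "\<not> ge 0 l2"
    then have l2: "l2 \<noteq> 0" "ge 1 (inverse l2)" using inv by auto
    moreover have "ge 1 (inverse l2 * l1)" by (intro ge_mult_0 that l2)
    moreover note ge_mono[OF calculation(2), of 0] ge_mono[OF calculation(3), of 0]
    ultimately show False
      by (intro model[of "inverse l2" 0 1 "-1" 0, OF _ _ _ _ _ _ _ _ refl]) (auto simp: conj_model_2)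
  qed
  show "l1 \<in> stalk C sh p \<longleftrightarrow> l2 \<in> stalk C sh p"
    using 1 2 by (auto simp: dv(2))
  \<comment> \<open>If \<open>l1 = l2 = 1\<close> in the residue field, both forms vanish at \<open>[-1 : 1]\<close>; the matrix moves this point
    to \<open>[1 : 0]\<close>.\<close>
  have False if l: "ge 1 (l1 - 1)" "ge 1 (l2 - 1)"
  proof -
    have "ge 0 (l1 - 1 + 1)" "ge 0 (l2 - 1 + 1)"
      by (intro ge_add ge_mono[OF l(1)] ge_mono[OF l(2)]; simp)+
    \<comment> \<open>These are \<open>b1\<close> and \<open>b0\<close> of the conjugated model,
      whose \<open>a0\<close> is \<open>l1 - 1\<close>.\<close>
    moreover have "ge 1 (- (l1 - 1) - (l2 - 1))" "ge 1 (l1 - 1 + (l2 - 1))" 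
      by (intro ge_diff ge_add l; simp only: ge_uminus l)+
    ultimately show False
      using l
      by (intro model[of 1 "-1" 0 1 "-1", OF _ _ _ _ _ _ _ _ refl]) (auto simp: conj_model_2 algebra_simps)
  qed
  then show "\<not> (l1 - 1 \<in> max_ideal C sh p \<and> l2 - 1 \<in> max_ideal C sh p)"
    by (auto simp: dv(3))
qed

text \<open>The identity matrix attains the value because the model has minimal valuation
  \<open>0\<close>; \<open>conj_normal_form_bound\<close> shows that no conjugate goes below
  it.\<close>

lemma min_resultant_normal_form:
  fixes C :: "'x topology" and sh :: "'x set \<Rightarrow> 'k::field_char_0 set" and \<phi> :: "'k P1_map"
  assumes "integral_scheme C sh"
    and p: "p \<in> topspace C" and dvr: "discrete_valuation_ring (local_ring C sh p)"
    and pres: "presentation 2 \<phi> (proj_point ring_of_type_algebra [1, l1, 0, 0, l2, 1])"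
    and l: "l1 \<in> stalk C sh p" "l2 \<in> stalk C sh p"
    and not_one: "\<not> (l1 - 1 \<in> max_ideal C sh p \<and> l2 - 1 \<in> max_ideal C sh p)"
  shows "min_resultant C sh 2 \<phi> p = val C sh p (resultant_form 2 [1, l1, 0, 0, l2, 1])"
proof -
  interpret integral_scheme C sh by fact
  let ?v = "[1, l1, 0, 0, l2, 1]"
  note dv = discrete_val_val[OF subring_stalk[OF p] dvr stalk_fractions[OF p]]
  interpret discrete_val "val C sh p" by (rule dv(1))
  have ge: "ge 0 l1" "ge 0 l2" "\<not> (ge 1 (l1 - 1) \<and> ge 1 (l2 - 1))"
    using l not_one by (auto simp: dv(2,3))
  have v_in: "?v \<in> proj_point ring_of_type_algebra ?v"
    unfolding proj_point_type_algebra by (auto intro!: exI[of _ 1])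
  have res: "resultant_form 2 ?v = 1 - l1 * l2"
    by (simp add: resultant_form_2)
  show ?thesis
    unfolding min_resultant_def
  proof (rule Least_equality)
    have "min_val C sh p ?v = 0"
      unfolding min_val_def by (rule Min_val_eq_0) (use ge in auto)
    then have "val C sh p (resultant_form 2 ?v) =
        res_order C sh 2 p (conj_model ring_of_type_algebra 2 (1, 0, 0, 1) ?v)"
      by (simp add: res_order_def conj_model_2_one)
    moreover have "(1, 0, 0, 1) \<in> GL2 (ring_of_type_algebra :: 'k ring)"
      by (auto simp: GL2_def Units_def)
    ultimately show "\<exists>\<Phi>. presentation 2 \<phi> \<Phi> \<and> (\<exists>v\<in>\<Phi>. \<exists>\<Gamma>\<in>GL2 ring_of_type_algebra.
        val C sh p (resultant_form 2 ?v) = res_order C sh 2 p (conj_model ring_of_type_algebra 2 \<Gamma> v))"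
      using pres v_in by blast
  next
    fix n
    assume "\<exists>\<Phi>. presentation 2 \<phi> \<Phi> \<and> (\<exists>v\<in>\<Phi>. \<exists>\<Gamma>\<in>GL2 ring_of_type_algebra.
        n = res_order C sh 2 p (conj_model ring_of_type_algebra 2 \<Gamma> v))"
    then obtain \<Phi> w \<alpha> \<beta> \<gamma> \<delta> where \<Phi>: "presentation 2 \<phi> \<Phi>" "w \<in> \<Phi>"
      and \<Gamma>: "(\<alpha>, \<beta>, \<gamma>, \<delta>) \<in> GL2 (ring_of_type_algebra :: 'k ring)"
      and n: "n = res_order C sh 2 p (conj_model ring_of_type_algebra 2 (\<alpha>, \<beta>, \<gamma>, \<delta>) w)"
      by (metis prod_cases4)
    \<comment> \<open>Besides the factor \<open>c\<close>, this gives that the resultant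
      \<open>1 - l1 * l2\<close> is nonzero, so that the valuation is additive on the products
      below.\<close>
    obtain c where c: "c \<noteq> 0" "w = map ((*) c) ?v" "l1 * l2 \<noteq> 1"
      using presentation_normal_form_unique[OF pres \<Phi>] by blast
    have D: "\<alpha> * \<delta> - \<beta> * \<gamma> \<noteq> 0"
      using \<Gamma> by (auto simp: GL2_def Units_def)
    define u where "u = conj_model ring_of_type_algebra 2 (\<alpha>, \<beta>, \<gamma>, \<delta>) w"
    have "resultant_form 2 w = c ^ 4 * (1 - l1 * l2)"
      by (simp add: c(2) resultant_form_2 algebra_simps power2_eq_square power4_eq_xxxx)
    then have "resultant_form 2 u = (\<alpha> * \<delta> - \<beta> * \<gamma>) ^ 6 * (c ^ 4 * (1 - l1 * l2))"
      unfolding u_def by (simp add: resultant_form_conj_2 c(2))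
    then have "val C sh p (resultant_form 2 u) =
        6 * val C sh p (\<alpha> * \<delta> - \<beta> * \<gamma>) + 4 * val C sh p c + val C sh p (1 - l1 * l2)"
      using D c by (simp add: v_mult v_power)
    moreover have "2 * min_val C sh p u \<le> 3 * val C sh p (\<alpha> * \<delta> - \<beta> * \<gamma>) + 2 * val C sh p c"
      by (rule conj_normal_form_bound[OF ge(1,2) c(1) D _ ge(3)])
        (use ge_Min_val[of _ u] in \<open>simp add: min_val_def u_def c(2)\<close>)
    ultimately show "val C sh p (resultant_form 2 ?v) \<le> n"
      unfolding n res_order_def u_def[symmetric] res by simp
  qed
qed

theorem theorem5p6:
  fixes C :: "'x topology" and sh :: "'x set \<Rightarrow> 'k::field_char_0 set"
    and \<phi> :: "'k P1_map" and l1 l2 :: 'k and \<Phi> :: "'k list set"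
  assumes "integral_scheme C sh"
    and "noetherian_scheme C sh"
    and "one_dimensional C"
    and "\<And>p. p \<in> closed_points C \<Longrightarrow> discrete_valuation_ring (local_ring C sh p)"
    and "\<Phi> = proj_point ring_of_type_algebra [1, l1, 0, 0, l2, 1]"
    and "presentation 2 \<phi> \<Phi>"
    and "\<And>p. p \<in> closed_points C \<Longrightarrow> semistable_reduction C sh 2 \<Phi> p"
  shows "poles C sh l1 = poles C sh l2 \<and>
    minimal_global_model C sh 2 (poles C sh l1 \<inter> poles C sh l2) \<phi> [1, l1, 0, 0, l2, 1]"
proof -
  interpret integral_scheme C sh by fact
  have top: "p \<in> topspace C" if "p \<in> closed_points C" for p
    using that closedin_subset by (fastforce simp: closed_points_def)
  \<comment> \<open>The stalk consists of the elements of nonnegative order, so having a pole means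
    lying outside the stalk.\<close>
  have poles: "poles C sh l = {p \<in> closed_points C. l \<notin> stalk C sh p}" for l
  proof -
    have "l \<noteq> 0 \<and> val C sh p l < 0 \<longleftrightarrow> l \<notin> stalk C sh p" if p: "p \<in> closed_points C" for p
    proof -
      note dv = discrete_val_val[OF subring_stalk[OF top[OF p]] assms(4)[OF p] stalk_fractions[OF top[OF p]]]
      show ?thesis
        by (simp add: dv(2) discrete_val.ge_def[OF dv(1)] not_le)
    qed
    then show ?thesis unfolding poles_def by blast
  qed
  have ss: "l1 \<in> stalk C sh p \<longleftrightarrow> l2 \<in> stalk C sh p"
      "\<not> (l1 - 1 \<in> max_ideal C sh p \<and> l2 - 1 \<in> max_ideal C sh p)" if p: "p \<in> closed_points C" for p
    using semistable_normal_form[OF top[OF p] assms(4)[OF p]] assms(7)[OF p] unfolding assms(5) by blast+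
  have eq: "poles C sh l1 = poles C sh l2"
    using ss(1) unfolding poles by blast
  define U where "U = topspace C - poles C sh l1"
  have U: "openin C U" "U \<noteq> {}" "l1 \<in> sh U"
    using openin_regular_locus[OF assms(3), of l1] regular_locus_nonempty[OF assms(3), of l1]
      section_regular_locus[OF assms(3), of l1] unfolding U_def poles by auto
  \<comment> \<open>\<open>l2\<close> is a section off its own poles, and by \<open>eq\<close> this
    is the same open set \<open>U\<close>.\<close>
  have "l2 \<in> sh U"
    using section_regular_locus[OF assms(3), of l2] unfolding U_def eq unfolding poles .
  then have "set [1, l1, 0, 0, l2, 1] \<subseteq> sh U"
    using U subringE(2,3)[OF sections_subring[OF U(1,2)]] by simp
  moreover have "poles C sh l1 \<subseteq> topspace C"
    using top unfolding poles by blast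
  moreover have "[1, l1, 0, 0, l2, 1] \<in> \<Phi>"
    unfolding assms(5) proj_point_type_algebra by (auto intro!: exI[of _ 1])
  moreover have "min_resultant C sh 2 \<phi> p = val C sh p (resultant_form 2 [1, l1, 0, 0, l2, 1])"
    if "p \<in> closed_points C - poles C sh l1" for p
    using that ss assms(1,4,6) top unfolding poles assms(5)
    by (intro min_resultant_normal_form) auto
  ultimately have "minimal_global_model C sh 2 (poles C sh l1) \<phi> [1, l1, 0, 0, l2, 1]"
    using U(1) assms(6) unfolding minimal_global_model_def U_def by blast
  then show ?thesis using eq by simp
qed

end
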